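(* Let $k \leq n$ be positive integers and let $\lambda = (\lambda_1 \geq \cdots \geq \lambda_s\ge0)$ be a partition of $k$ with $s$ parts. The harmonic space $V_{n,\lambda}$ is the smallest subspace of $\mathbb{Q}[x_1,\dots,x_n]$ which contains $\delta_T$ for every $T \in \mathrm{Inj}(\lambda, \leq n)$ and is closed under the partial derivative operators $\partial/\partial x_1, \dots, \partial/\partial x_n$. Equivalently, $\{ \delta_T : T \in \mathrm{Inj}(\lambda, \leq n) \}$ generates $V_{n,\lambda}$ as a $\mathbb{Q}[x_1,\dots,x_n]$-module under the action $f\odot g$.
   Context: A partition of $k$ with $s$ parts is a weakly decreasing sequence of $s$ nonnegative integers (trailing zeros allowed) summing to $k$; $\lambda'=(\lambda'_1,\dots,\lambda'_n)$ is its conjugate padded with zeros to length $n$. For $S\subseteq[n]$ and $d\ge0$, $e_d(S)$ is the degree $d$ elementary symmetric polynomial in $\{x_i:i\in S\}$ (zero if $d>|S|$). The ideal $I_{n,\lambda}\subseteq\mathbb{Q}[x_1,\dots,x_n]$ is generated by $x_1^s,\dots,x_n^s$ and all $e_d(S)$ with $S\subseteq[n]$ and $d>|S|-\lambda'_n-\cdots-\lambda'_{n-|S|+1}$. For $f\in\mathbb{Q}[x_1,\dots,x_n]$ let $\partial f=f(\partial/\partial x_1,\dots,\partial/\partial x_n)$ and $f\odot g=(\partial f)(g)$; $\langle f,g\rangle$ is the constant term of $f\odot g$. The harmonic space is $V_{n,\lambda}=\{g:\langle f,g\rangle=0\ \forall f\in I_{n,\lambda}\}$. $\mathrm{Inj}(\lambda,\le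 n)$: fillings of the Young diagram of $\lambda$ with distinct integers in $[n]$ strictly increasing down columns. For such $T$, $\mathbf{x}(T)=\prod_i x_i^{a_i}$ with $a_i$ the number of boxes directly below $i$ in its column if $i$ appears in $T$, else $a_i=s-1$; $C_T\subseteq\mathfrak{S}_n$ is the group of permutations stabilizing each column's entry set and fixing entries not in $T$; $\mathfrak{S}_n$ permutes variable subscripts; $\delta_T=\sum_{w\in C_T}\mathrm{sign}(w)\,w\cdot\mathbf{x}(T)$. *)

theory Defs
  imports Complex_Main "HOL-Library.Poly_Mapping" "HOL-Library.FuncSet"
    "HOL-Combinatorics.Permutations"
begin

section \<open>Polynomials with rational coefficients\<close>

text \<open>
  A polynomial is a finitely supported function from exponent vectors (themselves finitely
  supported functions from variable indices) to coefficients.  The type has countably many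
  variables; the ring in \<open>x\<^sub>1, \<dots>, x\<^sub>n\<close> is the carrier set \<open>polys n\<close>.
\<close>

type_synonym mpoly = "(nat \<Rightarrow>\<^sub>0 nat) \<Rightarrow>\<^sub>0 rat"

definition polys :: "nat \<Rightarrow> mpoly set" where
  "polys n = {p. \<forall>m \<in> Poly_Mapping.keys p. Poly_Mapping.keys m \<subseteq> {1..n}}"

definition var :: "nat \<Rightarrow> mpoly" where
  "var i = Poly_Mapping.single (Poly_Mapping.single i 1) 1"

definition const :: "rat \<Rightarrow> mpoly" where
  "const c = Poly_Mapping.single 0 c"

definition scale :: "rat \<Rightarrow> mpoly \<Rightarrow> mpoly" where
  "scale c p = const c * p"

interpretation mpoly: vector_space scale
  by unfold_locales
    (simp_all add: scale_def const_def single_add mult_single algebra_simps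
      flip: single_one mult.assoc)

definition elem_sym :: "nat \<Rightarrow> nat set \<Rightarrow> mpoly" where
  "elem_sym d S = (\<Sum>A | A \<subseteq> S \<and> card A = d. \<Prod>i\<in>A. var i)"

text \<open>Substitution of \<open>x\<^bsub>w i\<^esub>\<close> for \<open>x\<^sub>i\<close>:\<close>

definition permute_vars :: "(nat \<Rightarrow> nat) \<Rightarrow> mpoly \<Rightarrow> mpoly" where
  "permute_vars w p =
    (\<Sum>m\<in>Poly_Mapping.keys p. const (Poly_Mapping.lookup p m) *
      (\<Prod>i\<in>Poly_Mapping.keys m. var (w i) ^ Poly_Mapping.lookup m i))"

text \<open>
  In \<open>pdiff\<close>, subtraction of exponent vectors is truncated, but where truncation takes effect
  the factor \<open>lookup m i\<close> is zero.
\<close>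

definition pdiff :: "nat \<Rightarrow> mpoly \<Rightarrow> mpoly" where
  "pdiff i p =
    (\<Sum>m\<in>Poly_Mapping.keys p. Poly_Mapping.single (m - Poly_Mapping.single i 1)
      (of_nat (Poly_Mapping.lookup m i) * Poly_Mapping.lookup p m))"

text \<open>
  \<open>pdiff_monom m\<close> is the composition of the operators \<open>pdiff i ^^ lookup m i\<close>.  These commute;
  the composition is taken in increasing order of \<open>i\<close> only to have a definite expression.
\<close>

definition pdiff_monom :: "(nat \<Rightarrow>\<^sub>0 nat) \<Rightarrow> mpoly \<Rightarrow> mpoly" where
  "pdiff_monom m = foldr (\<lambda>i D. (pdiff i ^^ Poly_Mapping.lookup m i) \<circ> D)
    (sorted_list_of_set (Poly_Mapping.keys m)) id"

definition odot :: "mpoly \<Rightarrow> mpoly \<Rightarrow> mpoly" (infixr "\<odot>" 75) where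
  "f \<odot> g = (\<Sum>m\<in>Poly_Mapping.keys f. scale (Poly_Mapping.lookup f m) (pdiff_monom m g))"

definition pairing :: "mpoly \<Rightarrow> mpoly \<Rightarrow> rat" where
  "pairing f g = Poly_Mapping.lookup (f \<odot> g) 0"

text \<open>Ideals of the ring \<open>polys n\<close>:\<close>

definition is_ideal :: "nat \<Rightarrow> mpoly set \<Rightarrow> bool" where
  "is_ideal n J \<longleftrightarrow> J \<subseteq> polys n \<and> 0 \<in> J \<and>
    (\<forall>f\<in>J. \<forall>g\<in>J. f + g \<in> J) \<and> (\<forall>f\<in>polys n. \<forall>g\<in>J. f * g \<in> J)"

text \<open>Submodules of \<open>polys n\<close> for the action \<open>\<odot>\<close> of \<open>polys n\<close> on itself:\<close>

definition is_odot_submodule :: "nat \<Rightarrow> mpoly set \<Rightarrow> bool" where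
  "is_odot_submodule n M \<longleftrightarrow> M \<subseteq> polys n \<and> 0 \<in> M \<and>
    (\<forall>f\<in>M. \<forall>g\<in>M. f + g \<in> M) \<and> (\<forall>f\<in>polys n. \<forall>g\<in>M. f \<odot> g \<in> M)"

definition is_pdiff_closed_subspace :: "nat \<Rightarrow> mpoly set \<Rightarrow> bool" where
  "is_pdiff_closed_subspace n W \<longleftrightarrow> W \<subseteq> polys n \<and> mpoly.subspace W \<and>
    (\<forall>i\<in>{1..n}. \<forall>g\<in>W. pdiff i g \<in> W)"


section \<open>Partitions and the harmonic space\<close>

text \<open>Lists may end in zeros: the number of parts \<open>s\<close> is the length of the list.\<close>

definition is_partition :: "nat \<Rightarrow> nat \<Rightarrow> nat list \<Rightarrow> bool" where
  "is_partition k s lam \<longleftrightarrow> length lam = s \<and> sorted_wrt (\<ge>) lam \<and> sum_list lam = k"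

text \<open>\<open>conj_part lam j\<close> is \<open>\<lambda>'\<^sub>j\<close>, for \<open>j \<ge> 1\<close>; it is zero beyond the largest part.\<close>

definition conj_part :: "nat list \<Rightarrow> nat \<Rightarrow> nat" where
  "conj_part lam j = card {r. r < length lam \<and> j \<le> lam ! r}"

text \<open>
  The index set \<open>{n - card S + 1..n}\<close> gives the sum of the last \<open>|S|\<close> entries of the conjugate
  padded to length \<open>n\<close>.  The degree bound is stated over the integers to avoid truncation.
\<close>

definition ideal_gens :: "nat \<Rightarrow> nat list \<Rightarrow> mpoly set" where
  "ideal_gens n lam =
    {var i ^ length lam | i. i \<in> {1..n}} \<union>
    {elem_sym d S | d S. S \<subseteq> {1..n} \<and>
       int d > int (card S) - (\<Sum>j\<in>{n - card S + 1..n}. int (conj_part lam j))}"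

definition I_ideal :: "nat \<Rightarrow> nat list \<Rightarrow> mpoly set" where
  "I_ideal n lam = is_ideal n hull ideal_gens n lam"

definition harmonic_space :: "nat \<Rightarrow> nat list \<Rightarrow> mpoly set" where
  "harmonic_space n lam = {g \<in> polys n. \<forall>f \<in> I_ideal n lam. pairing f g = 0}"


section \<open>Injective fillings\<close>

text \<open>Boxes are pairs (row, column), both counted from zero, with rows going downwards.\<close>

definition diagram :: "nat list \<Rightarrow> (nat \<times> nat) set" where
  "diagram lam = {(r, c). r < length lam \<and> c < lam ! r}"

definition Inj_fillings :: "nat list \<Rightarrow> nat \<Rightarrow> (nat \<times> nat \<Rightarrow> nat) set" where
  "Inj_fillings lam n =
    {T \<in> diagram lam \<rightarrow>\<^sub>E {1..n}. inj_on T (diagram lam) \<and>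
       (\<forall>r r' c. (r, c) \<in> diagram lam \<longrightarrow> (r', c) \<in> diagram lam \<longrightarrow> r < r' \<longrightarrow>
          T (r, c) < T (r', c))}"

definition filling_exponent :: "nat list \<Rightarrow> (nat \<times> nat \<Rightarrow> nat) \<Rightarrow> nat \<Rightarrow> nat" where
  "filling_exponent lam T i =
    (if i \<in> T ` diagram lam
     then card {(r', c) \<in> diagram lam. \<exists>r<r'. (r, c) \<in> diagram lam \<and> T (r, c) = i}
     else length lam - 1)"

definition filling_monom :: "nat \<Rightarrow> nat list \<Rightarrow> (nat \<times> nat \<Rightarrow> nat) \<Rightarrow> mpoly" where
  "filling_monom n lam T = (\<Prod>i\<in>{1..n}. var i ^ filling_exponent lam T i)"

definition column_entries :: "nat list \<Rightarrow> (nat \<times> nat \<Rightarrow> nat) \<Rightarrow> nat \<Rightarrow> nat set" where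
  "column_entries lam T c = {T (r, c) | r. (r, c) \<in> diagram lam}"

definition column_group :: "nat \<Rightarrow> nat list \<Rightarrow> (nat \<times> nat \<Rightarrow> nat) \<Rightarrow> (nat \<Rightarrow> nat) set" where
  "column_group n lam T =
    {w. w permutes {1..n} \<and>
        (\<forall>c. w ` column_entries lam T c = column_entries lam T c) \<and>
        (\<forall>i \<in> {1..n} - T ` diagram lam. w i = i)}"

definition delta :: "nat \<Rightarrow> nat list \<Rightarrow> (nat \<times> nat \<Rightarrow> nat) \<Rightarrow> mpoly" where
  "delta n lam T =
    (\<Sum>w\<in>column_group n lam T. of_int (sign w) * permute_vars w (filling_monom n lam T))"

end

theory Submission
  imports Defs
begin

text \<open>
  Rescaled by factorials, the coefficients of a polynomial are merely shifted by differentiation.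
  Hence \<open>\<delta>\<^sub>T\<close> is harmonic as soon as the generators of the ideal annihilate it.  For \<open>e\<^sub>d(S)\<close> this
  uses that \<open>S\<close> contains all but at most \<open>n - |S|\<close> of the columns of \<open>T\<close>, so that every squarefree
  monomial of degree \<open>d\<close> in \<open>S\<close> meets a column \<open>C \<subseteq> S\<close>; there \<open>\<delta>\<^sub>T\<close> is alternating and has the
  exponents \<open>0, \<dots>, |C| - 1\<close>, so the contributions cancel in pairs or vanish.

  Conversely, the divisors of the monomials \<open>x(T)\<close> span the polynomial ring modulo the ideal, so a
  harmonic polynomial without such monomials is zero.  As \<open>x(T)\<close> is the lexicographically largest
  monomial of \<open>\<delta>\<^sub>T\<close>, every divisor of \<open>x(T)\<close> is the leading monomial of a derivative of \<open>\<delta>\<^sub>T\<close>.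
  Subtracting these derivatives removes all such monomials from a given harmonic polynomial.
\<close>

abbreviation lookup :: "('a \<Rightarrow>\<^sub>0 'b::zero) \<Rightarrow> 'a \<Rightarrow> 'b" where "lookup \<equiv> Poly_Mapping.lookup"
abbreviation keys :: "('a \<Rightarrow>\<^sub>0 'b::zero) \<Rightarrow> 'a set" where "keys \<equiv> Poly_Mapping.keys"
abbreviation single :: "'a \<Rightarrow> 'b \<Rightarrow> ('a \<Rightarrow>\<^sub>0 'b::zero)" where "single \<equiv> Poly_Mapping.single"

section \<open>Monomials\<close>

lemma lookup_scale [simp]: "lookup (scale c p) m = c * lookup p m"
proof -
  have "scale c p = Poly_Mapping.map ((*) c) p"
    by (simp add: scale_def const_def mult_map_scale_conv_mult)
  then show ?thesis
    by (simp add: Poly_Mapping.map.rep_eq when_def)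
qed

lemma sum_single_lookup:
  assumes "finite A" "keys p \<subseteq> A"
  shows "(\<Sum>m\<in>A. single m (lookup p m)) = p"
proof (rule poly_mapping_eqI)
  fix k
  have "lookup (\<Sum>m\<in>A. single m (lookup p m)) k = (\<Sum>m\<in>A. if m = k then lookup p k else 0)"
    unfolding lookup_sum by (rule sum.cong) (auto simp: lookup_single when_def)
  also have "\<dots> = lookup p k"
    using assms by (auto simp: in_keys_iff)
  finally show "lookup (\<Sum>m\<in>A. single m (lookup p m)) k = lookup p k" .
qed

lemma var_power: "var i ^ k = single (single i k) 1"
  by (induction k) (simp_all add: var_def mult_single flip: single_add)

lemma prod_monomials: "(\<Prod>i\<in>A. single (f i) (1::rat)) = single (\<Sum>i\<in>A. f i) 1"
  by (induction A rule: infinite_finite_induct) (simp_all add: mult_single)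

lemma lookup_sum_single:
  assumes "finite A"
  shows "lookup (\<Sum>i\<in>A. single i (f i)) j = (if j \<in> A then f j else 0)"
proof -
  have "lookup (\<Sum>i\<in>A. single i (f i)) j = (\<Sum>i\<in>A. if i = j then f j else 0)"
    unfolding lookup_sum by (rule sum.cong) (auto simp: lookup_single when_def)
  then show ?thesis using assms by simp
qed

lemma keys_add_nat: "keys (a + b) = keys a \<union> keys (b :: 'a \<Rightarrow>\<^sub>0 nat)"
  by (auto simp: in_keys_iff lookup_add)

lemma polys_0: "0 \<in> polys n"
  by (simp add: polys_def)

lemma polys_add: "p \<in> polys n \<Longrightarrow> q \<in> polys n \<Longrightarrow> p + q \<in> polys n"
  using Poly_Mapping.keys_add[of p q] by (auto simp: polys_def)

lemma polys_iff: "p \<in> polys n \<longleftrightarrow> (\<forall>m. lookup p m \<noteq> 0 \<longrightarrow> keys m \<subseteq> {1..n})"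
  by (auto simp: polys_def in_keys_iff)

lemma polys_scale: "p \<in> polys n \<Longrightarrow> scale c p \<in> polys n"
  by (auto simp: polys_iff)

lemma polys_mult:
  assumes "p \<in> polys n" "q \<in> polys n"
  shows "p * q \<in> polys n"
proof -
  have "keys m \<subseteq> {1..n}" if m: "m \<in> keys (p * q)" for m
  proof -
    obtain a b where "a \<in> keys p" "b \<in> keys q" "m = a + b"
      using m keys_mult[of p q] by blast
    then show ?thesis using assms by (auto simp: polys_def keys_add_nat)
  qed
  then show ?thesis by (simp add: polys_def)
qed

lemma single_in_polys: "keys m \<subseteq> {1..n} \<Longrightarrow> single m c \<in> polys n"
  by (simp add: polys_def)

lemma subspace_polys: "mpoly.subspace (polys n)"
  by (simp add: mpoly.subspace_def polys_0 polys_add polys_scale)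

lemma elem_sym_monomials:
  "elem_sym d S = (\<Sum>A | A \<subseteq> S \<and> card A = d. single (\<Sum>i\<in>A. single i 1) 1)"
  by (simp add: elem_sym_def var_def prod_monomials)

lemma keys_indicator: "finite A \<Longrightarrow> keys (\<Sum>i\<in>A. single i (Suc 0)) = A"
  by (auto simp: in_keys_iff lookup_sum_single split: if_splits)

lemma elem_sym_0: "finite S \<Longrightarrow> elem_sym 0 S = 1"
proof -
  assume "finite S"
  then have "{A. A \<subseteq> S \<and> card A = 0} = {{}}" by (auto dest: finite_subset)
  then show ?thesis by (simp add: elem_sym_def)
qed

text \<open>Subsets of \<open>insert b S\<close> are split by whether they contain \<open>b\<close>.
  This recursion lets \<open>monomials_spanned\<close> trade one degree for a factor
  \<open>var b\<close>.\<close>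

lemma elem_sym_insert:
  assumes "finite S" "b \<notin> S"
  shows "elem_sym (Suc d) (insert b S) = elem_sym (Suc d) S + var b * elem_sym d S"
proof -
  have "{A. A \<subseteq> insert b S \<and> card A = Suc d} =
      {A. A \<subseteq> S \<and> card A = Suc d} \<union> insert b ` {A. A \<subseteq> S \<and> card A = d}" (is "?L = ?R1 \<union> ?R2")
  proof
    show "?L \<subseteq> ?R1 \<union> ?R2"
    proof
      fix A assume A: "A \<in> ?L"
      then have fin: "finite A" using assms by (auto intro: finite_subset)
      show "A \<in> ?R1 \<union> ?R2"
      proof (cases "b \<in> A")
        case True
        then have "A = insert b (A - {b})" "A - {b} \<subseteq> S" "card (A - {b}) = d"
          using A fin by auto
        then show ?thesis by blast
      qed (use A in auto)
    qed
    show "?R1 \<union> ?R2 \<subseteq> ?L"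
    proof -
      have "card (insert b A) = Suc (card A)" if "A \<subseteq> S" for A
        using assms that by (subst card_insert_disjoint) (auto dest: finite_subset)
      then show ?thesis by auto
    qed
  qed
  moreover have "?R1 \<inter> ?R2 = {}" "finite ?R1" "finite ?R2"
    using assms by auto
  ultimately have "elem_sym (Suc d) (insert b S) =
      elem_sym (Suc d) S + (\<Sum>A\<in>?R2. \<Prod>i\<in>A. var i)"
    by (simp add: elem_sym_def sum.union_disjoint)
  also have "(\<Sum>A\<in>?R2. \<Prod>i\<in>A. var i) = (\<Sum>A | A \<subseteq> S \<and> card A = d. \<Prod>i\<in>insert b A. var i)"
    using assms by (subst sum.reindex) (auto simp: inj_on_def)
  also have "\<dots> = (\<Sum>A | A \<subseteq> S \<and> card A = d. var b * (\<Prod>i\<in>A. var i))"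
    using assms by (intro sum.cong refl prod.insert) (auto dest: finite_subset)
  finally show ?thesis by (simp add: elem_sym_def sum_distrib_left)
qed

section \<open>The contraction action\<close>

definition mfact :: "(nat \<Rightarrow>\<^sub>0 nat) \<Rightarrow> rat" where
  "mfact m = (\<Prod>i\<in>keys m. fact (lookup m i))"

lemma mfact_superset: "finite A \<Longrightarrow> keys m \<subseteq> A \<Longrightarrow> mfact m = (\<Prod>i\<in>A. fact (lookup m i))"
  unfolding mfact_def by (rule prod.mono_neutral_left) (auto simp: in_keys_iff)

lemma mfact_nonzero [simp]: "mfact m \<noteq> 0"
  by (simp add: mfact_def)

lemma mfact_add_single: "mfact (m + single i 1) = of_nat (lookup m i + 1) * mfact m"
proof -
  let ?A = "insert i (keys m)"
  have "mfact (m + single i 1) = (\<Prod>j\<in>?A. fact (lookup (m + single i 1) j))"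
    by (rule mfact_superset) (auto simp: keys_add_nat)
  also have "\<dots> = (\<Prod>j\<in>?A. (if j = i then of_nat (lookup m i + 1) else 1) * fact (lookup m j))"
    by (rule prod.cong) (auto simp: lookup_add lookup_single when_def)
  also have "\<dots> = of_nat (lookup m i + 1) * (\<Prod>j\<in>?A. fact (lookup m j))"
    by (simp add: prod.distrib)
  also have "(\<Prod>j\<in>?A. fact (lookup m j)) = mfact m"
    by (rule mfact_superset[symmetric]) auto
  finally show ?thesis .
qed

text \<open>Rescaling coefficients by factorials turns differentiation into a shift of exponents.\<close>

definition ncoeff :: "mpoly \<Rightarrow> (nat \<Rightarrow>\<^sub>0 nat) \<Rightarrow> rat" where
  "ncoeff p m = mfact m * lookup p m"

lemma ncoeff_eqI: "(\<And>m. ncoeff p m = ncoeff q m) \<Longrightarrow> p = q"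
  by (rule poly_mapping_eqI) (simp add: ncoeff_def)

lemma ncoeff_0 [simp]: "ncoeff 0 m = 0"
  and ncoeff_add: "ncoeff (p + q) m = ncoeff p m + ncoeff q m"
  and ncoeff_scale: "ncoeff (scale c p) m = c * ncoeff p m"
  and ncoeff_sum: "ncoeff (sum f A) m = (\<Sum>x\<in>A. ncoeff (f x) m)"
  by (simp_all add: ncoeff_def lookup_add lookup_sum algebra_simps sum_distrib_left)

lemma ncoeff_eq_0_iff: "ncoeff p m = 0 \<longleftrightarrow> lookup p m = 0"
  by (simp add: ncoeff_def)

lemma lookup_pdiff:
  "lookup (pdiff i p) m = of_nat (lookup m i + 1) * lookup p (m + single i 1)"
proof -
  let ?m = "m + single i 1"
  have "lookup (pdiff i p) m = (\<Sum>m'\<in>keys p. if m' = ?m then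
      of_nat (lookup m i + 1) * lookup p ?m else 0)"
    unfolding pdiff_def lookup_sum
  proof (rule sum.cong[OF refl])
    fix m'
    show "lookup (single (m' - single i 1) (of_nat (lookup m' i) * lookup p m')) m =
        (if m' = ?m then of_nat (lookup m i + 1) * lookup p ?m else 0)"
    proof (cases "m' = ?m")
      case True
      then show ?thesis by (simp add: lookup_add)
    next
      case False
      \<comment> \<open>Truncated subtraction sends further exponents to \<open>m\<close>, but only
        ones without \<open>i\<close>, and for these the coefficient is zero.\<close>
      have "m' = ?m" if "m' - single i 1 = m" "lookup m' i \<noteq> 0"
        using that by (auto intro!: poly_mapping_eqI simp: lookup_add lookup_minus lookup_single when_def)
      then show ?thesis using False by (auto simp: lookup_single when_def)
    qed
  qed
  then show ?thesis by (simp add: in_keys_iff)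
qed

lemma ncoeff_pdiff: "ncoeff (pdiff i p) m = ncoeff p (m + single i 1)"
  by (simp only: ncoeff_def lookup_pdiff mfact_add_single) (simp add: ac_simps)

lemma ncoeff_pdiff_power: "ncoeff ((pdiff i ^^ k) p) m = ncoeff p (m + single i k)"
proof (induction k arbitrary: m)
  case (Suc k)
  then show ?case by (simp add: ncoeff_pdiff add.assoc flip: single_add)
qed simp

text \<open>Every operator in the fold is a shift of rescaled coefficients, so composing them adds
  the shifts up to \<open>a\<close>.\<close>

lemma ncoeff_pdiff_monom: "ncoeff (pdiff_monom a p) m = ncoeff p (m + a)"
proof -
  have *: "ncoeff (foldr (\<lambda>i D. (pdiff i ^^ f i) \<circ> D) xs id p) m =
      ncoeff p (m + (\<Sum>i\<leftarrow>xs. single i (f i)))" for f xs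
    by (induction xs arbitrary: m) (simp_all add: ncoeff_pdiff_power ac_simps)
  have "(\<Sum>i\<leftarrow>sorted_list_of_set (keys a). single i (lookup a i)) = (\<Sum>i\<in>keys a. single i (lookup a i))"
    by (simp add: sum_list_distinct_conv_sum_set)
  also have "\<dots> = a"
    by (simp add: sum_single_lookup)
  finally show ?thesis
    unfolding pdiff_monom_def * by simp
qed

text \<open>The linear extension of \<open>\<phi>\<close> from monomials to polynomials; for
  \<open>\<phi> = ncoeff g\<close> it is the pairing with \<open>g\<close>.\<close>

definition contract :: "((nat \<Rightarrow>\<^sub>0 nat) \<Rightarrow> rat) \<Rightarrow> mpoly \<Rightarrow> rat" where
  "contract \<phi> f = (\<Sum>a\<in>keys f. lookup f a * \<phi> a)"

lemma contract_superset:
  "finite A \<Longrightarrow> keys f \<subseteq> A \<Longrightarrow> contract \<phi> f = (\<Sum>a\<in>A. lookup f a * \<phi> a)"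
  unfolding contract_def by (rule sum.mono_neutral_left) (auto simp: in_keys_iff)

lemma contract_add: "contract \<phi> (f + g) = contract \<phi> f + contract \<phi> g"
proof -
  let ?A = "keys f \<union> keys g"
  have "contract \<phi> (f + g) = (\<Sum>a\<in>?A. lookup (f + g) a * \<phi> a)"
    using Poly_Mapping.keys_add[of f g] by (intro contract_superset) auto
  also have "\<dots> = (\<Sum>a\<in>?A. lookup f a * \<phi> a) + (\<Sum>a\<in>?A. lookup g a * \<phi> a)"
    by (simp add: lookup_add algebra_simps sum.distrib)
  finally show ?thesis
    using contract_superset[of ?A f] contract_superset[of ?A g] by simp
qed

lemma contract_0 [simp]: "contract \<phi> 0 = 0"
  by (simp add: contract_def)

lemma contract_sum: "contract \<phi> (sum f A) = (\<Sum>x\<in>A. contract \<phi> (f x))"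
  by (induction A rule: infinite_finite_induct) (simp_all add: contract_add)

lemma contract_single [simp]: "contract \<phi> (single m c) = c * \<phi> m"
  using contract_superset[of "{m}" "single m c"] by simp

lemma contract_scale: "contract \<phi> (scale c f) = c * contract \<phi> f"
proof -
  have "contract \<phi> (scale c f) = (\<Sum>a\<in>keys f. lookup (scale c f) a * \<phi> a)"
    by (rule contract_superset) (auto simp: in_keys_iff)
  then show ?thesis by (simp add: contract_def sum_distrib_left mult.assoc)
qed

lemma contract_mult: "contract \<phi> (f * g) = contract (\<lambda>a. contract (\<lambda>b. \<phi> (a + b)) g) f"
proof -
  have "f * g = (\<Sum>a\<in>keys f. \<Sum>b\<in>keys g. single (a + b) (lookup f a * lookup g b))"
    using sum_single_lookup[of "keys f" f] sum_single_lookup[of "keys g" g]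
    by (simp flip: mult_single sum_product)
  then have "contract \<phi> (f * g) = (\<Sum>a\<in>keys f. \<Sum>b\<in>keys g. lookup f a * lookup g b * \<phi> (a + b))"
    by (simp add: contract_sum)
  then show ?thesis
    by (simp add: contract_def sum_distrib_left mult.assoc)
qed

text \<open>In rescaled coefficients the action contracts a shifted coefficient function, so the
  module laws follow coefficientwise from those of \<open>contract\<close>.\<close>

lemma ncoeff_odot: "ncoeff (f \<odot> g) m = contract (\<lambda>a. ncoeff g (m + a)) f"
  by (simp add: odot_def ncoeff_sum ncoeff_scale ncoeff_pdiff_monom contract_def)

lemma odot_mult: "(f * g) \<odot> p = f \<odot> g \<odot> p"
  by (rule ncoeff_eqI) (simp add: ncoeff_odot contract_mult add.assoc)

lemma odot_add_left: "(f + g) \<odot> p = f \<odot> p + g \<odot> p"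
  by (rule ncoeff_eqI) (simp add: ncoeff_odot contract_add ncoeff_add)

lemma odot_0_left: "0 \<odot> p = 0"
  by (simp add: odot_def)

lemma odot_0_right: "f \<odot> 0 = 0"
  by (rule ncoeff_eqI) (simp add: ncoeff_odot contract_def)

lemma odot_var: "var i \<odot> p = pdiff i p"
  by (rule ncoeff_eqI) (simp add: ncoeff_odot var_def ncoeff_pdiff)

lemma odot_const: "const c \<odot> p = scale c p"
  by (rule ncoeff_eqI) (simp add: ncoeff_odot const_def ncoeff_scale)

lemma mfact_0 [simp]: "mfact 0 = 1"
  by (simp add: mfact_def)

lemma pairing_contract: "pairing f g = contract (ncoeff g) f"
proof -
  have "pairing f g = ncoeff (f \<odot> g) 0"
    by (simp add: pairing_def ncoeff_def)
  also have "\<dots> = contract (ncoeff g) f"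
    by (simp add: ncoeff_odot)
  finally show ?thesis .
qed

text \<open>This adjointness of differentiation and multiplication turns the ideal property into
  closure of the harmonic space under derivatives.\<close>

lemma pairing_pdiff: "pairing f (pdiff i g) = pairing (var i * f) g"
proof -
  have "ncoeff (pdiff i g) = (\<lambda>a. ncoeff g (a + single i 1))"
    by (rule ext) (rule ncoeff_pdiff)
  then show ?thesis
    by (subst mult.commute) (simp add: pairing_contract contract_mult var_def)
qed

lemma pdiff_in_polys:
  assumes "p \<in> polys n"
  shows "pdiff i p \<in> polys n"
  unfolding polys_iff
proof (intro allI impI)
  fix m assume "lookup (pdiff i p) m \<noteq> 0"
  then have "lookup p (m + single i 1) \<noteq> 0" unfolding lookup_pdiff by auto
  then have "keys (m + single i 1) \<subseteq> {1..n}" using assms unfolding polys_iff by blast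
  then show "keys m \<subseteq> {1..n}" by (simp add: keys_add_nat)
qed

lemma pdiff_monom_closed:
  assumes W: "is_pdiff_closed_subspace n W" and a: "keys a \<subseteq> {1..n}" and p: "p \<in> W"
  shows "pdiff_monom a p \<in> W"
proof -
  have pow: "(pdiff i ^^ k) q \<in> W" if "i \<in> {1..n}" "q \<in> W" for i k q
    using W that by (induction k) (auto simp: is_pdiff_closed_subspace_def)
  have *: "foldr (\<lambda>i D. (pdiff i ^^ f i) \<circ> D) xs id p \<in> W" if "set xs \<subseteq> {1..n}" for f xs
    using that p by (induction xs) (auto intro: pow)
  show ?thesis
    unfolding pdiff_monom_def by (rule *) (use a in auto)
qed

lemma odot_closed:
  assumes W: "is_pdiff_closed_subspace n W" and "f \<in> polys n" "g \<in> W"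
  shows "f \<odot> g \<in> W"
proof -
  have "mpoly.subspace W" using W by (simp add: is_pdiff_closed_subspace_def)
  then show ?thesis
    unfolding odot_def using assms
    by (intro mpoly.subspace_sum mpoly.subspace_scale pdiff_monom_closed[OF W]) (auto simp: polys_def)
qed

text \<open>Constants act as scalars and variables as partial derivatives; conversely
  \<open>f \<odot> g\<close> is a linear combination of iterated derivatives. Hence both
  formulations of the theorem concern the same subspaces.\<close>

lemma odot_submodule_iff:
  "is_odot_submodule n W \<longleftrightarrow> is_pdiff_closed_subspace n W"
proof
  assume W: "is_odot_submodule n W"
  have "scale c g \<in> W" if "g \<in> W" for c g
    using W that odot_const[of c g] single_in_polys[of 0 n c]
    unfolding is_odot_submodule_def const_def by (metis empty_subsetI keys_zero)
  moreover have "pdiff i g \<in> W" if "g \<in> W" "i \<in> {1..n}" for i g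
    using W that odot_var[of i g] single_in_polys[of "single i 1" n 1]
    unfolding is_odot_submodule_def var_def by force
  ultimately show "is_pdiff_closed_subspace n W"
    using W by (auto simp: is_odot_submodule_def is_pdiff_closed_subspace_def mpoly.subspace_def)
next
  assume "is_pdiff_closed_subspace n W"
  then show "is_odot_submodule n W"
    using odot_closed[of n W]
    by (auto simp: is_odot_submodule_def is_pdiff_closed_subspace_def mpoly.subspace_def)
qed

section \<open>Substaircase monomials span modulo the ideal\<close>

text \<open>
  \<open>c i = Some j\<close> puts \<open>i\<close> into column \<open>j\<close>, which has height \<open>h j\<close> (columns count from zero), and
  \<open>c i = None\<close> leaves \<open>i\<close> out of the filling; the bound on the exponent of \<open>x\<^sub>i\<close> is its exponent
  in the monomial of that filling.
\<close>

definition substaircase :: "nat set \<Rightarrow> (nat \<Rightarrow> nat) \<Rightarrow> nat \<Rightarrow> (nat \<Rightarrow>\<^sub>0 nat) \<Rightarrow> bool" where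
  "substaircase N h s a \<longleftrightarrow> keys a \<subseteq> N \<and>
    (\<exists>c. (\<forall>j. card {i\<in>N. c i = Some j} = h j) \<and>
      (\<forall>i\<in>N. lookup a i \<le> (if c i = None then s - 1 else card {i'\<in>N. i < i' \<and> c i' = c i})))"

text \<open>As \<open>b\<close> is smaller than all of \<open>A\<close>, the bounds for
  \<open>A\<close> do not change, and \<open>b\<close> put into column \<open>j\<close> is followed
  there by all \<open>h' j\<close> entries, which is the bound on its exponent.\<close>

lemma substaircase_insert_min:
  assumes fin: "finite A" and min: "\<forall>a\<in>A. b < a" and a: "substaircase A h' s a"
    and col: "case col of None \<Rightarrow> h = h' \<and> i < s | Some j \<Rightarrow> h = h'(j := Suc (h' j)) \<and> i \<le> h' j"
  shows "substaircase (insert b A) h s (single b i + a)"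
proof -
  from a obtain c where ka: "keys a \<subseteq> A" and card: "\<And>j. card {i\<in>A. c i = Some j} = h' j"
    and le: "\<And>i. i \<in> A \<Longrightarrow> lookup a i \<le> (if c i = None then s - 1 else card {i'\<in>A. i < i' \<and> c i' = c i})"
    unfolding substaircase_def by blast
  have bA: "b \<notin> A" using min by blast
  define c' where "c' = c(b := col)"
  have set_eq: "{i \<in> insert b A. c' i = Some j} =
      (if col = Some j then insert b {i\<in>A. c i = Some j} else {i\<in>A. c i = Some j})" for j
    using bA by (auto simp: c'_def)
  have later_b: "{i' \<in> insert b A. b < i' \<and> c' i' = c' b} = {i'\<in>A. c i' = col}"
    using bA min by (auto simp: c'_def)
  have later: "{i' \<in> insert b A. i < i' \<and> c' i' = c' i} = {i'\<in>A. i < i' \<and> c i' = c i}"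
    if "i \<in> A" for i
    using that bA min by (auto simp: c'_def)
  have "card {i \<in> insert b A. c' i = Some j} = h j" for j
    using col fin bA unfolding set_eq by (auto simp: card split: option.splits)
  moreover have "lookup (single b i + a) i' \<le>
      (if c' i' = None then s - 1 else card {i''\<in>insert b A. i' < i'' \<and> c' i'' = c' i'})"
    if "i' \<in> insert b A" for i'
  proof (cases "i' = b")
    case True
    have "lookup a b = 0" using ka bA by (auto simp: in_keys_iff)
    then show ?thesis
      using col unfolding True later_b
      by (auto simp: lookup_add c'_def card split: option.splits)
  next
    case False
    then have "i' \<in> A" using that by auto
    then show ?thesis
      using le[of i'] False unfolding later[OF \<open>i' \<in> A\<close>]
      by (simp add: lookup_add lookup_single c'_def)
  qed
  moreover have "keys (single b i + a) \<subseteq> insert b A"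
    using ka by (auto simp: keys_add_nat split: if_splits)
  ultimately show ?thesis
    unfolding substaircase_def by blast
qed

text \<open>The indices with \<open>i < h j\<close> form an initial segment because \<open>h\<close>
  decreases, and \<open>L\<close> is its length.\<close>

lemma antimono_threshold:
  fixes h :: "nat \<Rightarrow> nat"
  assumes "antimono h" "h B \<le> i"
  obtains L where "L \<le> B" "\<And>j. j < L \<Longrightarrow> i < h j" "\<And>j. L \<le> j \<Longrightarrow> h j \<le> i"
proof
  let ?L = "LEAST j. h j \<le> i"
  show "?L \<le> B" using assms(2) by (rule Least_le)
  show "i < h j" if "j < ?L" for j using not_less_Least[OF that] by simp
  show "h j \<le> i" if "?L \<le> j" for j
    using LeastI[of "\<lambda>j. h j \<le> i", OF assms(2)] antimonoD[OF assms(1) that] by simp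
qed

text \<open>
  Induction on the set of variables, removing the smallest one \<open>x\<^sub>b\<close>.  Modulo \<open>x\<^sub>b\<^sup>i\<^sup>+\<^sup>1\<close>, multiplication by
  \<open>x\<^sub>b\<^sup>i\<close> carries the generators for the remaining variables and the heights \<open>h'\<close>, where the last
  column of height greater than \<open>i\<close> is shortened by one (if there is one), into the ideal.
\<close>

lemma monomials_spanned:
  assumes "finite N" "antimono h" "\<And>j. B \<le> j \<Longrightarrow> h j = 0" "mpoly.subspace U"
    and pow: "\<And>i q. i \<in> N \<Longrightarrow> keys q \<subseteq> N \<Longrightarrow> single q 1 * var i ^ s \<in> U"
    and elem: "\<And>S d q. S \<subseteq> N \<Longrightarrow> card S < d + (\<Sum>j\<in>{card N - card S..<B}. h j) \<Longrightarrow> keys q \<subseteq> N \<Longrightarrow>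
      single q 1 * elem_sym d S \<in> U"
    and stair: "\<And>a. substaircase N h s a \<Longrightarrow> single a 1 \<in> U"
    and "keys m \<subseteq> N"
  shows "single m 1 \<in> U"
  using assms
proof (induction N arbitrary: h U m rule: finite_linorder_min_induct)
  case empty
  \<comment> \<open>Without variables only the constant monomial remains. It is substaircase if all
    heights are zero; otherwise \<open>elem_sym 0 {} = 1\<close> meets the degree bound and lies in
    \<open>U\<close>.\<close>
  show ?case
  proof (cases "\<forall>j. h j = 0")
    case True
    then have "substaircase {} h s m" using empty by (simp add: substaircase_def)
    then show ?thesis using empty by blast
  next
    case False
    then obtain j where "h j \<noteq> 0" by blast
    moreover from this have "j < B" using empty(2)[of j] by force
    ultimately have "0 < (\<Sum>j\<in>{0..<B}. h j)"
      by (metis atLeastLessThan_iff bot_nat_0.extremum finite_atLeastLessThan gr_zeroI sum_eq_0_iff)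
    then show ?thesis
      using empty(5)[of "{}" 0 0] empty(7) by (simp add: elem_sym_0)
  qed
next
  case (insert b A)
  note fin = \<open>finite A\<close> and min = \<open>\<forall>a\<in>A. b < a\<close> and anti = \<open>antimono h\<close>
    and hB = insert.prems(2) and sub = \<open>mpoly.subspace U\<close>
    and pow = insert.prems(4) and elem = insert.prems(5) and stair = insert.prems(6)
  have bA: "b \<notin> A" using min by blast
  have U_sum: "sum f X \<in> U" if "\<And>x. x \<in> X \<Longrightarrow> f x \<in> U" for f and X :: "nat set set"
    using sub that by (intro mpoly.subspace_sum)
  have U_diff: "p - q \<in> U" if "p \<in> U" "q \<in> U" for p q
    using sub that by (intro mpoly.subspace_diff)
  \<comment> \<open>Downward induction on the exponent \<open>i\<close> of the removed variable:
    from \<open>s\<close> on the power generator applies, and below it \<open>next_U\<close>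
    provides the case \<open>Suc i\<close>.\<close>
  have shift: "single (single b i + m) 1 \<in> U" if "keys m \<subseteq> A" for i m
    using that
  proof (induction "s - i" arbitrary: i m)
    case 0
    have "single b i + m = single b (i - s) + m + single b s"
      using 0 by (intro poly_mapping_eqI) (simp add: lookup_add lookup_single when_def)
    then have "single (single b i + m) 1 = single (single b (i - s) + m) 1 * var b ^ s"
      by (simp add: var_power mult_single)
    also have "\<dots> \<in> U"
      using 0 by (intro pow) (auto simp: keys_add_nat split: if_splits)
    finally show ?case .
  next
    case (Suc e)
    then have i: "i < s" by simp
    have next_U: "single (single b (Suc i) + m) 1 \<in> U" if "keys m \<subseteq> A" for m
      using Suc.hyps(1)[of "Suc i" m] Suc.hyps(2) that by simp
    obtain L where L: "L \<le> B" "\<And>j. j < L \<Longrightarrow> i < h j" "\<And>j. L \<le> j \<Longrightarrow> h j \<le> i"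
      using antimono_threshold[OF anti, of B i] hB by auto
    define h' where "h' = (if L = 0 then h else h(L - 1 := h (L - 1) - 1))"
    have h'_pos: "i \<le> h' (L - 1)" "h = h'(L - 1 := Suc (h' (L - 1)))" if "L \<noteq> 0"
      using that L(2)[of "L - 1"] by (auto simp: h'_def)
    \<comment> \<open>The induction hypothesis is applied to the preimage of \<open>U\<close> under
      multiplication by the \<open>i\<close>-th power of \<open>var b\<close>.\<close>
    define U' where "U' = {f. single (single b i) 1 * f \<in> U}"
    have "single m 1 \<in> U'"
    proof (rule insert.IH[of h'])
      \<comment> \<open>Only comparisons with column \<open>L - 1\<close> could fail: later columns
        have height at most \<open>i\<close>, and the shortened one still has height at least
        \<open>i\<close>.\<close>
      show "antimono h'"
      proof (rule antimonoI)
        fix x y :: nat assume xy: "x \<le> y"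
        have "h y \<le> h x" using antimonoD[OF anti xy] .
        moreover have "h y \<le> i" if "x = L - 1" "y \<noteq> x" "L \<noteq> 0"
          using L(3)[of y] that xy by simp
        ultimately show "h' y \<le> h' x"
          using L(2)[of "L - 1"] by (auto simp: h'_def)
      qed
      show "h' j = 0" if "B \<le> j" for j
        using hB[OF that] by (auto simp: h'_def)
      show "mpoly.subspace U'"
      proof -
        have "single (single b i) 1 * scale c x = scale c (single (single b i) 1 * x)" for c x
          by (simp add: scale_def mult.left_commute)
        then show ?thesis
          using sub by (simp add: mpoly.subspace_def U'_def distrib_left)
      qed
      show "single q 1 * var j ^ s \<in> U'" if "j \<in> A" "keys q \<subseteq> A" for j q
      proof -
        have "single (single b i + q) 1 * var j ^ s \<in> U"
          using that by (intro pow) (auto simp: keys_add_nat)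
        then show ?thesis by (simp add: U'_def mult_single flip: mult.assoc)
      qed
      show "single a 1 \<in> U'" if "substaircase A h' s a" for a
      proof -
        \<comment> \<open>The variable \<open>b\<close> becomes the missing entry of column
          \<open>L - 1\<close>, or stays out of the filling if no column is higher than
          \<open>i\<close>.\<close>
        have "substaircase (insert b A) h s (single b i + a)"
        proof (rule substaircase_insert_min[OF fin min that])
          show "case (if L = 0 then None else Some (L - 1)) of None \<Rightarrow> h = h' \<and> i < s
              | Some j \<Rightarrow> h = h'(j := Suc (h' j)) \<and> i \<le> h' j"
          proof (cases "L = 0")
            case True
            then show ?thesis using i by (simp add: h'_def)
          next
            case False
            show ?thesis
              unfolding if_not_P[OF False] option.case using h'_pos[OF False] by (intro conjI)
          qed
        qed
        from stair[OF this] show ?thesis by (simp add: U'_def mult_single)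
      qed
      show "keys m \<subseteq> A" by fact
      fix S d and q :: "nat \<Rightarrow>\<^sub>0 nat"
      assume S: "S \<subseteq> A" and d: "card S < d + (\<Sum>j\<in>{card A - card S..<B}. h' j)"
        and q: "keys q \<subseteq> A"
      have finS: "finite S" and bS: "b \<notin> S"
        using S fin bA by (auto intro: finite_subset)
      have card_le: "card S \<le> card A" using S fin by (rule card_mono[rotated])
      define t where "t = card A - card S"
      have cN: "card (insert b A) = Suc (card A)" "card (insert b S) = Suc (card S)"
        using fin finS bA bS by auto
      \<comment> \<open>Adding \<open>b\<close> to both sets keeps the codimension \<open>t\<close>,
        so \<open>insert b S\<close> has the same tail of heights in its degree bound.\<close>
      have xe: "single (single b l + q) 1 * elem_sym d' (insert b S) \<in> U"
        if "Suc (card S) < d' + (\<Sum>j\<in>{t..<B}. h j)" for l d'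
      proof (rule elem)
        show "insert b S \<subseteq> insert b A" using S by blast
        show "card (insert b S) < d' + (\<Sum>j\<in>{card (insert b A) - card (insert b S)..<B}. h j)"
          using that by (simp add: cN t_def)
        show "keys (single b l + q) \<subseteq> insert b A"
          using q by (auto simp: keys_add_nat split: if_splits)
      qed
      have xx: "single (single b l + q) 1 * (var b * p) = single (single b (Suc l) + q) 1 * p" for l p
      proof -
        have "single b l + q + single b 1 = single b (Suc l) + q"
          by (rule poly_mapping_eqI) (simp add: lookup_add lookup_single when_def)
        then show ?thesis unfolding var_def mult.assoc[symmetric] mult_single by simp
      qed
      have "single (single b i + q) 1 * elem_sym d S \<in> U"
      proof (cases "L \<le> t")
        case False
        \<comment> \<open>The shortened column belongs to the tail, so the extra unit in
          \<open>h\<close> offsets the larger size of \<open>insert b S\<close>. Then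
          \<open>elem_sym d (insert b S)\<close> differs from \<open>elem_sym d S\<close> by a
          multiple of \<open>var b\<close>, covered by \<open>next_U\<close>.\<close>
        have "(\<Sum>j\<in>{t..<B}. h j) = (\<Sum>j\<in>{t..<B}. h' j) + 1"
        proof -
          have L1: "L - 1 \<in> {t..<B}" using False L(1) by auto
          have "(\<Sum>j\<in>{t..<B}. h j) = h (L - 1) + (\<Sum>j\<in>{t..<B} - {L - 1}. h j)"
            using L1 by (intro sum.remove) auto
          moreover have "(\<Sum>j\<in>{t..<B}. h' j) = h' (L - 1) + (\<Sum>j\<in>{t..<B} - {L - 1}. h' j)"
            using L1 by (intro sum.remove) auto
          moreover have "(\<Sum>j\<in>{t..<B} - {L - 1}. h' j) = (\<Sum>j\<in>{t..<B} - {L - 1}. h j)"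
            by (rule sum.cong) (auto simp: h'_def)
          ultimately show ?thesis
            using False L(2)[of "L - 1"] by (simp add: h'_def)
        qed
        then have big: "single (single b i + q) 1 * elem_sym d (insert b S) \<in> U"
          using d by (intro xe) (simp add: t_def)
        show ?thesis
        proof (cases d)
          case 0
          then show ?thesis using big finS by (simp add: elem_sym_0)
        next
          case (Suc d')
          have "single (single b (Suc i) + q) 1 * elem_sym d' S \<in> U"
            unfolding elem_sym_monomials sum_distrib_left
          proof (rule U_sum)
            fix X assume X: "X \<in> {X. X \<subseteq> S \<and> card X = d'}"
            then have "finite X" using finS by (auto intro: finite_subset)
            then have "keys (q + (\<Sum>i\<in>X. single i 1)) \<subseteq> A"
              using X S q by (auto simp: keys_add_nat keys_indicator)
            from next_U[OF this]
            show "single (single b (Suc i) + q) 1 * single (\<Sum>i\<in>X. single i 1) 1 \<in> U"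
              by (simp add: mult_single add.assoc)
          qed
          from U_diff[OF big[unfolded Suc elem_sym_insert[OF finS bS] distrib_left xx] this]
          show ?thesis by (simp add: Suc)
        qed
      next
        case True
        have same: "(\<Sum>j\<in>{t..<B}. h' j) = (\<Sum>j\<in>{t..<B}. h j)"
          using True by (intro sum.cong) (auto simp: h'_def)
        \<comment> \<open>Here the tails agree, so the degree is first raised by \<open>i\<close>,
          which makes up for losing column \<open>t\<close> of height at most \<open>i\<close> when
          \<open>S\<close> is viewed inside \<open>insert b A\<close>. Each step then trades one
          degree for a factor \<open>var b\<close>.\<close>
        have "single (single b l + q) 1 * elem_sym (d + (i - l)) S \<in> U" if "l \<le> i" for l
          using that
        proof (induction l)
          case 0
          have "(\<Sum>j\<in>{t..<B}. h j) \<le> h t + (\<Sum>j\<in>{Suc t..<B}. h j)"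
            by (cases "t < B") (simp_all add: sum.atLeast_Suc_lessThan)
          also have "h t \<le> i" using L(3) True by simp
          finally have "card S < d + i + (\<Sum>j\<in>{Suc t..<B}. h j)"
            using d same by (simp add: t_def)
          then have "single q 1 * elem_sym (d + i) S \<in> U"
            using S q card_le by (intro elem) (auto simp: cN t_def Suc_diff_le)
          then show ?case by simp
        next
          case (Suc l)
          define d' where "d' = d + (i - Suc l)"
          have d': "d + (i - l) = Suc d'" using Suc.prems by (simp add: d'_def)
          have sum: "single (single b l + q) 1 * elem_sym (Suc d') (insert b S) \<in> U"
            using d same by (intro xe) (simp add: d'_def t_def)
          have "single (single b l + q) 1 * elem_sym (Suc d') S \<in> U"
            using Suc d' by simp
          from U_diff[OF sum[unfolded elem_sym_insert[OF finS bS] distrib_left xx] this]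
          show ?case by (simp add: d'_def)
        qed
        from this[of i] show ?thesis by simp
      qed
      then show "single q 1 * elem_sym d S \<in> U'"
        by (simp add: U'_def mult_single flip: mult.assoc)
    qed
    then show ?case by (simp add: U'_def mult_single)
  qed
  define m' where "m' = m - single b (lookup m b)"
  have split: "single b (lookup m b) + m' = m"
    by (rule poly_mapping_eqI) (simp add: m'_def lookup_add lookup_minus lookup_single when_def)
  have "keys m' \<subseteq> A"
  proof
    fix x assume "x \<in> keys m'"
    then have "x \<in> keys m" "x \<noteq> b"
      by (auto simp: m'_def in_keys_iff lookup_minus lookup_single when_def)
    then show "x \<in> A" using insert.prems(7) by auto
  qed
  from shift[OF this, of "lookup m b"] show ?case unfolding split .
qed

section \<open>The polynomials \<open>\<delta>\<^sub>T\<close>\<close>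

definition act :: "(nat \<Rightarrow> nat) \<Rightarrow> (nat \<Rightarrow>\<^sub>0 nat) \<Rightarrow> (nat \<Rightarrow>\<^sub>0 nat)" where
  "act w m = (\<Sum>i\<in>keys m. single (w i) (lookup m i))"

lemma lookup_act:
  assumes "bij w"
  shows "lookup (act w m) j = lookup m (inv w j)"
proof -
  have "lookup (act w m) j = (\<Sum>i\<in>keys m. if i = inv w j then lookup m (inv w j) else 0)"
    unfolding act_def lookup_sum
    using assms by (intro sum.cong refl) (auto simp: lookup_single when_def bij_inv_eq_iff bij_is_inj)
  then show ?thesis by (simp add: in_keys_iff)
qed

text \<open>Renaming variables only permutes the factorials, so sign rules for coefficients carry
  over to \<open>ncoeff\<close>.\<close>

lemma mfact_act:
  assumes "bij w"
  shows "mfact (act w m) = mfact m"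
proof -
  have "keys (act w m) = w ` keys m"
  proof (rule set_eqI)
    fix j
    have "j = w (inv w j)" using assms by (simp add: bij_is_surj surj_f_inv_f)
    then show "j \<in> keys (act w m) \<longleftrightarrow> j \<in> w ` keys m"
      using assms by (auto simp: in_keys_iff lookup_act bij_is_inj)
  qed
  moreover have "inj_on w (keys m)" using assms by (auto simp: bij_def intro: inj_on_subset)
  ultimately show ?thesis
    using assms by (simp add: mfact_def prod.reindex lookup_act bij_is_inj)
qed

lemma permute_vars_single: "permute_vars w (single m 1) = single (act w m) 1"
  by (simp add: permute_vars_def const_def var_power prod_monomials act_def)

section \<open>Entries, exponents and column group of a fixed filling\<close>

locale filling =
  fixes n :: nat and lam :: "nat list" and T :: "nat \<times> nat \<Rightarrow> nat"
  assumes T: "T \<in> Inj_fillings lam n"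
begin

abbreviation K :: "nat \<Rightarrow> nat set" where "K \<equiv> column_entries lam T"
abbreviation E :: "nat \<Rightarrow> nat" where "E \<equiv> filling_exponent lam T"
abbreviation G :: "(nat \<Rightarrow> nat) set" where "G \<equiv> column_group n lam T"

lemma T_in: "x \<in> diagram lam \<Longrightarrow> T x \<in> {1..n}"
  and T_inj: "inj_on T (diagram lam)"
  and T_less: "(r, c) \<in> diagram lam \<Longrightarrow> (r', c) \<in> diagram lam \<Longrightarrow> r < r' \<Longrightarrow> T (r, c) < T (r', c)"
  using T by (auto simp: Inj_fillings_def)

lemma T_less_iff:
  "(r, c) \<in> diagram lam \<Longrightarrow> (r', c) \<in> diagram lam \<Longrightarrow> T (r, c) < T (r', c) \<longleftrightarrow> r < r'"
  using T_less[of r c r'] T_less[of r' c r] by (cases r r' rule: linorder_cases) auto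

lemma K_subset: "K c \<subseteq> {1..n}"
  using T_in by (auto simp: column_entries_def)

lemma finite_K: "finite (K c)"
  using K_subset by (rule finite_subset) simp

lemma K_disjoint: "i \<in> K c \<Longrightarrow> i \<in> K c' \<Longrightarrow> c = c'"
  using T_inj by (auto simp: column_entries_def inj_on_def)

lemma in_image_iff: "i \<in> T ` diagram lam \<longleftrightarrow> (\<exists>c. i \<in> K c)"
  by (force simp: column_entries_def image_iff)

lemma card_K: "card (K c) = conj_part lam (Suc c)"
proof -
  have "K c = (\<lambda>r. T (r, c)) ` {r. r < length lam \<and> Suc c \<le> lam ! r}"
    by (auto simp: column_entries_def diagram_def)
  moreover have "inj_on (\<lambda>r. T (r, c)) {r. r < length lam \<and> Suc c \<le> lam ! r}"
    by (rule inj_onI) (use T_inj in \<open>force simp: inj_on_def diagram_def\<close>)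
  ultimately show ?thesis by (simp add: card_image conj_part_def)
qed

text \<open>Entries increase down a column, so the boxes below \<open>i\<close> are those with
  larger entries.\<close>

lemma E_column:
  assumes "i \<in> K c"
  shows "E i = card {i'\<in>K c. i < i'}"
proof -
  obtain r where r: "(r, c) \<in> diagram lam" "i = T (r, c)"
    using assms by (auto simp: column_entries_def)
  let ?B = "{(r', c) \<in> diagram lam. \<exists>r<r'. (r, c) \<in> diagram lam \<and> T (r, c) = i}"
  have "T ` ?B = {i'\<in>K c. i < i'}"
  proof (intro equalityI subsetI)
    fix x assume "x \<in> T ` ?B"
    then obtain r' c' r0 where x: "x = T (r', c')" "(r', c') \<in> diagram lam" "r0 < r'"
      "(r0, c') \<in> diagram lam" "T (r0, c') = i" by auto
    then have "(r0, c') = (r, c)" using T_inj r by (auto simp: inj_on_def)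
    then show "x \<in> {i'\<in>K c. i < i'}"
      using x r T_less by (auto simp: column_entries_def)
  next
    fix x assume "x \<in> {i'\<in>K c. i < i'}"
    then obtain r' where "x = T (r', c)" "(r', c) \<in> diagram lam" "i < T (r', c)"
      by (auto simp: column_entries_def)
    then show "x \<in> T ` ?B"
      using r T_less_iff by auto
  qed
  moreover have "card (T ` ?B) = card ?B"
    by (intro card_image inj_on_subset[OF T_inj]) auto
  ultimately have "card {i'\<in>K c. i < i'} = card ?B"
    by simp
  moreover have "i \<in> T ` diagram lam" using r by auto
  ultimately show ?thesis by (simp add: filling_exponent_def)
qed

lemma E_strict_antimono: "p \<in> K c \<Longrightarrow> q \<in> K c \<Longrightarrow> p < q \<Longrightarrow> E q < E p"
  by (simp add: E_column finite_K) (rule psubset_card_mono, auto simp: finite_K)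

lemma E_inj_on: "inj_on E (K c)"
  by (rule inj_onI) (metis E_strict_antimono less_irrefl linorder_neqE_nat)

lemma E_less_card: "i \<in> K c \<Longrightarrow> E i < card (K c)"
  by (simp add: E_column finite_K) (rule psubset_card_mono, auto simp: finite_K)

text \<open>A column has at most \<open>length lam\<close> boxes, and for numbers outside the
  filling the bound is attained by definition.\<close>

lemma E_le: "E i \<le> length lam - 1"
proof (cases "i \<in> T ` diagram lam")
  case True
  then obtain c where "i \<in> K c" by (auto simp: in_image_iff)
  from E_less_card[OF this] have "E i < conj_part lam (Suc c)" by (simp add: card_K)
  also have "\<dots> \<le> card {..<length lam}"
    unfolding conj_part_def by (rule card_mono) auto
  finally show ?thesis by simp
qed (simp add: filling_exponent_def)

definition top_exp :: "nat \<Rightarrow>\<^sub>0 nat" where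
  "top_exp = (\<Sum>i\<in>{1..n}. single i (E i))"

lemma lookup_top: "lookup top_exp i = (if i \<in> {1..n} then E i else 0)"
  unfolding top_exp_def by (rule lookup_sum_single) simp

lemma filling_monom_top: "filling_monom n lam T = single top_exp 1"
  by (simp add: filling_monom_def var_power prod_monomials top_exp_def)

lemma GD:
  assumes "w \<in> G"
  shows "w permutes {1..n}" "w ` K c = K c" "i \<notin> T ` diagram lam \<Longrightarrow> w i = i"
proof -
  show "w permutes {1..n}" "w ` K c = K c" using assms by (auto simp: column_group_def)
  then show "w i = i" if "i \<notin> T ` diagram lam"
    using assms that permutes_not_in[of w "{1..n}" i] unfolding column_group_def by blast
qed

lemma G_inv:
  assumes w: "w \<in> G" and i: "i \<in> K c"
  shows "inv w i \<in> K c"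
proof -
  have "i \<in> w ` K c" using GD(2)[OF w] i by simp
  then obtain j where "j \<in> K c" "w j = i" by blast
  then show ?thesis using permutes_inv_eq[OF GD(1)[OF w]] by metis
qed

lemma G_inv_fixes:
  assumes w: "w \<in> G" and i: "i \<notin> T ` diagram lam"
  shows "inv w i = i"
  using GD(3)[OF w i] permutes_inv_eq[OF GD(1)[OF w]] by metis

lemma finite_G: "finite G"
  by (rule finite_subset[OF _ finite_permutations[of "{1..n}"]]) (auto simp: column_group_def)

lemma id_in_G: "id \<in> G"
  by (simp add: column_group_def permutes_id)

lemma delta_eq: "delta n lam T = (\<Sum>w\<in>G. single (act w top_exp) (of_int (sign w)))"
proof -
  have "of_int (sign w) * single (act w top_exp) 1 = (single (act w top_exp) (of_int (sign w)) :: mpoly)" for w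
    by (metis (no_types, lifting) add_0 mult.right_neutral mult_single single_of_int)
  then show ?thesis
    by (simp add: delta_def filling_monom_top permute_vars_single)
qed

lemma lookup_delta:
  "lookup (delta n lam T) m = (\<Sum>w\<in>G. if act w top_exp = m then of_int (sign w) else 0)"
  by (simp add: delta_eq lookup_sum lookup_single when_def)

lemma bij_G: "w \<in> G \<Longrightarrow> bij w"
  using GD(1) permutes_bij by blast

lemma lookup_act_top: "w \<in> G \<Longrightarrow> lookup (act w top_exp) i = lookup top_exp (inv w i)"
  by (simp add: lookup_act bij_G)

lemma lookup_act_top_column: "w \<in> G \<Longrightarrow> i \<in> K c \<Longrightarrow> lookup (act w top_exp) i = E (inv w i)"
  using G_inv[of w i c] K_subset[of c] by (auto simp: lookup_act_top lookup_top)

lemma delta_support: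
  assumes "lookup (delta n lam T) m \<noteq> 0"
  obtains w where "w \<in> G" "m = act w top_exp"
proof -
  have "\<exists>w\<in>G. m = act w top_exp"
  proof (rule ccontr)
    assume "\<not> ?thesis"
    then have "lookup (delta n lam T) m = 0"
      unfolding lookup_delta by (intro sum.neutral) auto
    with assms show False by simp
  qed
  then show ?thesis using that by blast
qed

lemma delta_in_polys: "delta n lam T \<in> polys n"
  unfolding polys_iff
proof (intro allI impI subsetI)
  fix m i assume "lookup (delta n lam T) m \<noteq> 0" "i \<in> keys m"
  then obtain w where w: "w \<in> G" "lookup (act w top_exp) i \<noteq> 0"
    by (metis delta_support in_keys_iff)
  then have "inv w i \<in> {1..n}" by (auto simp: lookup_act_top lookup_top split: if_splits)
  then show "i \<in> {1..n}" using permutes_in_image[OF permutes_inv[OF GD(1)[OF w(1)]]] by blast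
qed

lemma delta_exponent_le:
  "lookup (delta n lam T) m \<noteq> 0 \<Longrightarrow> lookup m i \<le> length lam - 1"
  by (erule delta_support) (use E_le in \<open>auto simp: lookup_act_top lookup_top\<close>)

text \<open>On a column \<open>E\<close> is injective with values below the number of boxes, and
  \<open>w\<close> merely permutes these values.\<close>

lemma delta_column:
  assumes "lookup (delta n lam T) m \<noteq> 0"
  shows "lookup m ` K c = {..<card (K c)}"
proof -
  obtain w where w: "w \<in> G" "m = act w top_exp" using assms by (rule delta_support)
  have "inj_on (lookup m) (K c)"
  proof (rule inj_onI)
    fix x y assume xy: "x \<in> K c" "y \<in> K c" "lookup m x = lookup m y"
    then have "E (inv w x) = E (inv w y)"
      by (simp add: w(2) lookup_act_top_column[OF w(1)])
    then have "inv w x = inv w y"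
      using inj_onD[OF E_inj_on, of _ _ c] G_inv[OF w(1), of _ c] xy by simp
    then show "x = y" using GD(1)[OF w(1)] by (metis permutes_inverses(1))
  qed
  moreover have "lookup m ` K c \<subseteq> {..<card (K c)}"
    using G_inv[OF w(1)] E_less_card by (auto simp: w(2) lookup_act_top_column[OF w(1)])
  ultimately show ?thesis
    by (intro card_subset_eq) (auto simp: card_image)
qed

lemma transpose_in_G:
  assumes p: "p \<in> K c" and q: "q \<in> K c" and w: "w \<in> G"
  shows "transpose p q \<circ> w \<in> G"
proof -
  let ?t = "transpose p q"
  have "?t permutes {1..n}" using p q K_subset[of c] by (intro permutes_swap_id) auto
  then have "?t \<circ> w permutes {1..n}" using GD(1)[OF w] by (rule permutes_compose[rotated])
  moreover have "?t ` K c' = K c'" for c'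
  proof (cases "c' = c")
    case True then show ?thesis using p q by simp
  next
    case False
    then have "p \<notin> K c'" "q \<notin> K c'" using p q K_disjoint by blast+
    then show ?thesis by simp
  qed
  then have "(?t \<circ> w) ` K c' = K c'" for c' using GD(2)[OF w] by (metis image_comp)
  moreover have "(?t \<circ> w) i = i" if "i \<notin> T ` diagram lam" for i
    using GD(3)[OF w that] that p q in_image_iff by (metis comp_apply transpose_apply_other)
  ultimately show ?thesis by (simp add: column_group_def)
qed

text \<open>Composition with the transposition is a bijection of the column group that reverses
  signs.\<close>

lemma delta_alternating:
  assumes p: "p \<in> K c" and q: "q \<in> K c" and pq: "p \<noteq> q"
  shows "lookup (delta n lam T) (act (transpose p q) m) = - lookup (delta n lam T) m"
proof -
  let ?t = "transpose p q"
  have act: "act ?t (act w top_exp) = act (?t \<circ> w) top_exp" if "w \<in> G" for w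
    using bij_G[OF that]
    by (intro poly_mapping_eqI) (simp add: lookup_act bij_comp o_inv_distrib)
  have invol: "act ?t (act ?t m) = m" for m
    by (intro poly_mapping_eqI) (simp add: lookup_act)
  have sgn: "sign (?t \<circ> w) = - sign w" if "w \<in> G" for w
  proof -
    have "permutation w" using GD(1)[OF that] by (auto simp: permutation_permutes)
    then show ?thesis using pq by (simp add: sign_compose permutation_swap_id sign_swap_id)
  qed
  have "lookup (delta n lam T) (act ?t m) =
      (\<Sum>w\<in>G. if act w top_exp = act ?t m then of_int (sign w) else 0)"
    by (rule lookup_delta)
  also have "\<dots> = (\<Sum>w\<in>G. if act (?t \<circ> w) top_exp = act ?t m then of_int (sign (?t \<circ> w)) else 0)"
    by (rule sum.reindex_bij_witness[where i = "\<lambda>w. ?t \<circ> w" and j = "\<lambda>w. ?t \<circ> w"])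
      (auto simp: transpose_in_G[OF p q] simp flip: comp_assoc)
  also have "\<dots> = (\<Sum>w\<in>G. - (if act w top_exp = m then of_int (sign w) else 0))"
    by (rule sum.cong) (auto simp: sgn act[symmetric] dest: arg_cong[where f = "act ?t"] simp: invol)
  finally show ?thesis by (simp add: lookup_delta sum_negf)
qed

text \<open>Exponent vectors are ordered lexicographically, the first differing index deciding. The
  first index moved by \<open>inv w\<close> goes to a larger entry of its column, where the exponent
  is smaller; so only \<open>w = id\<close> yields \<open>top_exp\<close>.\<close>

lemma delta_top: "lookup (delta n lam T) top_exp = 1"
  and delta_leading: "lookup (delta n lam T) m \<noteq> 0 \<Longrightarrow> m \<le> top_exp"
proof -
  have lead: "act w top_exp < top_exp" if w: "w \<in> G" "w \<noteq> id" for w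
  proof -
    let ?v = "inv w"
    have v: "?v permutes {1..n}" using GD(1)[OF w(1)] by (rule permutes_inv)
    have "\<exists>i. ?v i \<noteq> i"
    proof (rule ccontr)
      assume "\<not> ?thesis"
      then have "w i = i" for i using permutes_inverses[OF GD(1)[OF w(1)]] by metis
      then show False using w(2) by auto
    qed
    define i where "i = (LEAST i. ?v i \<noteq> i)"
    have i: "?v i \<noteq> i" unfolding i_def by (rule LeastI_ex) fact
    have less: "?v j = j" if "j < i" for j
      using not_less_Least[of j "\<lambda>i. ?v i \<noteq> i"] that by (auto simp: i_def)
    have "i < ?v i"
    proof (rule ccontr)
      assume "\<not> i < ?v i"
      then have "?v (?v i) = ?v i" using i by (intro less) simp
      then show False using i permutes_inj[OF v] by (simp add: inj_eq)
    qed
    moreover obtain c where c: "i \<in> K c"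
      using G_inv_fixes[OF w(1), of i] i by (auto simp: in_image_iff)
    ultimately have "E (?v i) < E i"
      using G_inv[OF w(1)] by (intro E_strict_antimono)
    then have "lookup (act w top_exp) i < lookup top_exp i"
      using c K_subset[of c] by (auto simp: lookup_act_top_column[OF w(1) c] lookup_top)
    moreover have "\<forall>j<i. lookup (act w top_exp) j = lookup top_exp j"
      using less by (simp add: lookup_act_top w)
    ultimately show ?thesis
      by (auto simp: less_poly_mapping.rep_eq less_fun_def)
  qed
  have act_id: "act id top_exp = top_exp"
    by (rule poly_mapping_eqI) (simp add: lookup_act)
  have "lookup (delta n lam T) top_exp = (\<Sum>w\<in>G. if w = id then 1 else 0)"
    unfolding lookup_delta by (rule sum.cong) (use lead act_id in \<open>auto dest: less_imp_neq\<close>)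
  then show "lookup (delta n lam T) top_exp = 1"
    by (simp add: finite_G id_in_G)
  show "m \<le> top_exp" if "lookup (delta n lam T) m \<noteq> 0"
    using that by (rule delta_support) (use lead act_id in \<open>metis less_imp_le order_refl\<close>)
qed

end

section \<open>Heights of columns and annihilation of \<open>\<delta>\<^sub>T\<close> by the
  generators\<close>

lemma sum_antimono_le:
  fixes h :: "nat \<Rightarrow> nat"
  assumes "antimono h" "finite D"
  shows "sum h D \<le> sum h {..<card D}"
  using assms(2)
proof (induction D rule: finite_linorder_max_induct)
  case (insert b A)
  \<comment> \<open>The largest element of a set is at least the number of the others, so the value
    of \<open>h\<close> at \<open>card A\<close> is at least \<open>h b\<close>.\<close>
  have "card A \<le> card {..<b}" by (rule card_mono) (use insert.hyps in auto)
  then have "h b \<le> h (card A)" by (intro antimonoD[OF assms(1)]) simp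
  moreover have "b \<notin> A" using insert.hyps by blast
  ultimately show ?case using insert by simp
qed simp

lemma down_closed_eq_lessThan:
  assumes "finite D" "\<And>r r'. r \<in> D \<Longrightarrow> r' < r \<Longrightarrow> r' \<in> D"
  shows "D = {..<card D :: nat}"
proof (rule card_subset_eq)
  show "D \<subseteq> {..<card D}"
  proof
    fix r assume "r \<in> D"
    then have "{..r} \<subseteq> D" using assms(2) by (auto simp: le_less)
    then have "card {..r} \<le> card D" by (rule card_mono[OF assms(1)])
    then show "r \<in> {..<card D}" by simp
  qed
qed simp_all

text \<open>Columns count from zero here, as in \<open>diagram\<close>, while
  \<open>conj_part\<close> counts from one.\<close>

definition heights :: "nat list \<Rightarrow> nat \<Rightarrow> nat" where
  "heights lam j = conj_part lam (Suc j)"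

lemma antimono_heights: "antimono (heights lam)"
  by (rule antimonoI) (auto simp: heights_def conj_part_def intro!: card_mono)

lemma sum_conj_part: "(\<Sum>j\<in>{t + 1..n}. int (conj_part lam j)) = int (\<Sum>j\<in>{t..<n}. heights lam j)"
proof -
  have "(\<Sum>j\<in>{t + 1..n}. conj_part lam j) = (\<Sum>j\<in>{t..<n}. heights lam j)"
    by (rule sum.reindex_bij_witness[where i = Suc and j = "\<lambda>j. j - 1"]) (auto simp: heights_def)
  then show ?thesis by (simp only: flip: of_nat_sum)
qed

lemma lookup_indicator: "finite A \<Longrightarrow> lookup (\<Sum>i\<in>A. single i (Suc 0)) j = (if j \<in> A then 1 else 0)"
  by (simp add: lookup_sum_single)

context filling
begin

lemma card_K_heights: "card (K c) = heights lam c"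
  by (simp add: card_K heights_def)

text \<open>Each element outside \<open>S\<close> spoils at most one column.\<close>

lemma card_columns_inside:
  assumes S: "S \<subseteq> {1..n}"
  shows "(\<Sum>j\<in>{n - card S..<n}. heights lam j) \<le> card (\<Union>c\<in>{c\<in>{..<n}. K c \<subseteq> S}. K c)"
proof -
  define good where "good = {c\<in>{..<n}. K c \<subseteq> S}"
  define bad where "bad = {c\<in>{..<n}. \<not> K c \<subseteq> S}"
  have "\<forall>c\<in>bad. \<exists>i. i \<in> K c - S" by (auto simp: bad_def)
  then obtain f where f: "\<And>c. c \<in> bad \<Longrightarrow> f c \<in> K c - S" by metis
  have "card bad \<le> card ({1..n} - S)"
  proof (rule card_inj_on_le)
    show "inj_on f bad" using f K_disjoint by (intro inj_onI) (metis DiffD1)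
    show "f ` bad \<subseteq> {1..n} - S" using f K_subset by blast
  qed simp
  also have "\<dots> = n - card S" using S by (subst card_Diff_subset) (auto intro: finite_subset)
  \<comment> \<open>The bad columns, at most \<open>n - card S\<close> many, have no more boxes than
    the first \<open>n - card S\<close> columns; subtracting from the total over \<open>n\<close>
    columns leaves the claim for the good ones.\<close>
  finally have "sum (heights lam) {..<card bad} \<le> sum (heights lam) {..<n - card S}"
    by (intro sum_mono2) auto
  moreover have "sum (heights lam) bad \<le> sum (heights lam) {..<card bad}"
    by (rule sum_antimono_le[OF antimono_heights]) (simp add: bad_def)
  moreover have "sum (heights lam) {..<n} = sum (heights lam) good + sum (heights lam) bad"
    by (subst sum.union_disjoint[symmetric]) (auto simp: good_def bad_def intro!: sum.cong)
  moreover have "sum (heights lam) {..<n} =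
      sum (heights lam) {..<n - card S} + sum (heights lam) {n - card S..<n}"
    by (subst sum.union_disjoint[symmetric]) (auto intro!: sum.cong)
  moreover have "card (\<Union>c\<in>good. K c) = sum (heights lam) good"
    by (subst card_UN_disjoint) (use K_disjoint in \<open>auto simp: good_def finite_K card_K_heights\<close>)
  ultimately show ?thesis by (simp add: good_def)
qed

text \<open>The rescaled coefficient at \<open>m\<close> is a sum of those of
  \<open>\<delta>\<^sub>T\<close> at \<open>m + ind A\<close>. If \<open>m\<close> takes equal
  values at two entries of a column inside \<open>S\<close>, swapping these cancels the sum;
  otherwise each term is zero by itself.\<close>

lemma elem_sym_annihilates:
  assumes S: "S \<subseteq> {1..n}" and d: "card S < d + (\<Sum>j\<in>{n - card S..<n}. heights lam j)"
  shows "elem_sym d S \<odot> delta n lam T = 0"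
proof (rule ncoeff_eqI)
  fix m
  define \<D> where "\<D> = {A. A \<subseteq> S \<and> card A = d}"
  define ind where "ind A = (\<Sum>i\<in>A. single i (Suc 0))" for A :: "nat set"
  define t where "t A = ncoeff (delta n lam T) (m + ind A)" for A
  have finS: "finite S" using S by (rule finite_subset) simp
  have fin: "finite A" if "A \<in> \<D>" for A
    using that finS by (auto simp: \<D>_def intro: finite_subset)
  have "ncoeff (elem_sym d S \<odot> delta n lam T) m = (\<Sum>A\<in>\<D>. t A)"
    by (simp add: ncoeff_odot elem_sym_monomials contract_sum \<D>_def t_def ind_def)
  also have "\<dots> = 0"
  proof (cases "\<exists>c p q. K c \<subseteq> S \<and> p \<in> K c \<and> q \<in> K c \<and> p \<noteq> q \<and> lookup m p = lookup m q")
    case True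
    then obtain c p q where c: "K c \<subseteq> S" and pq: "p \<in> K c" "q \<in> K c" "p \<noteq> q"
      and m: "lookup m p = lookup m q" by blast
    let ?\<tau> = "transpose p q"
    have mem: "j \<in> ?\<tau> ` A \<longleftrightarrow> ?\<tau> j \<in> A" for j A
      by (metis image_iff transpose_involutory)
    have neg: "t (?\<tau> ` A) = - t A" if "A \<in> \<D>" for A
    proof -
      have "m + ind (?\<tau> ` A) = act ?\<tau> (m + ind A)"
      proof (rule poly_mapping_eqI)
        fix j
        have "lookup m (?\<tau> j) = lookup m j" using m by (auto simp: transpose_def)
        then show "lookup (m + ind (?\<tau> ` A)) j = lookup (act ?\<tau> (m + ind A)) j"
          using fin[OF that] mem by (simp add: lookup_act lookup_add ind_def lookup_indicator)
      qed
      then show ?thesis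
        by (simp add: t_def ncoeff_def delta_alternating[OF pq] mfact_act)
    qed
    have swap: "?\<tau> ` A \<in> \<D>" if "A \<in> \<D>" for A
    proof -
      have "card (?\<tau> ` A) = card A" by (intro card_image inj_on_subset[OF inj_transpose]) simp
      moreover have "?\<tau> ` A \<subseteq> S"
        using that c pq by (auto simp: \<D>_def transpose_def)
      ultimately show ?thesis using that by (simp add: \<D>_def)
    qed
    \<comment> \<open>The swap permutes \<open>\<D>\<close> and negates each term, so the sum equals
      its own negative.\<close>
    have "(\<Sum>A\<in>\<D>. t A) = (\<Sum>A\<in>\<D>. t (?\<tau> ` A))"
      by (rule sum.reindex_bij_witness[where i = "\<lambda>A. ?\<tau> ` A" and j = "\<lambda>A. ?\<tau> ` A"])
        (auto simp: swap image_image)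
    also have "\<dots> = - (\<Sum>A\<in>\<D>. t A)" by (simp add: neg sum_negf)
    finally show ?thesis by simp
  next
    case False
    then have inj: "inj_on (lookup m) (K c)" if "K c \<subseteq> S" for c
      using that by (auto simp: inj_on_def)
    have "t A = 0" if A: "A \<in> \<D>" for A
    proof (rule ccontr)
      let ?M = "m + ind A"
      assume "t A \<noteq> 0"
      then have M: "lookup (delta n lam T) ?M \<noteq> 0" by (simp add: t_def ncoeff_eq_0_iff)
      define cols where "cols = (\<Union>c\<in>{c\<in>{..<n}. K c \<subseteq> S}. K c)"
      \<comment> \<open>The part of \<open>S\<close> outside the columns it contains has fewer than
        \<open>d\<close> elements.\<close>
      have "\<not> A \<subseteq> S - cols"
      proof
        assume "A \<subseteq> S - cols"
        then have "card A \<le> card (S - cols)" using finS by (intro card_mono) auto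
        also have "\<dots> = card S - card cols"
          using finS by (intro card_Diff_subset) (auto simp: cols_def finite_K)
        finally have "d \<le> card S - card cols" using A by (simp add: \<D>_def)
        moreover have "card cols \<le> card S" by (rule card_mono[OF finS]) (auto simp: cols_def)
        ultimately show False using d card_columns_inside[OF S] by (simp add: cols_def)
      qed
      then obtain x c where x: "x \<in> A" "x \<in> K c" and c: "K c \<subseteq> S"
        using A by (auto simp: \<D>_def cols_def)
      have MK: "lookup ?M ` K c = {..<card (K c)}" using M by (rule delta_column)
      have lM: "lookup ?M i = lookup m i + (if i \<in> A then 1 else 0)" for i
        using fin[OF A] by (simp add: lookup_add ind_def lookup_indicator)
      \<comment> \<open>On \<open>K c\<close> the values of \<open>m\<close> are distinct and
        bounded by those of \<open>?M\<close>, so both run through the same exponents and have equal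
        sums, although \<open>x\<close> makes the sum for \<open>?M\<close> larger.\<close>
      have "lookup m ` K c = {..<card (K c)}"
      proof (rule card_subset_eq)
        have "lookup m i < card (K c)" if "i \<in> K c" for i
        proof -
          have "lookup ?M i \<in> {..<card (K c)}" using MK that by blast
          then show ?thesis using lM[of i] by simp
        qed
        then show "lookup m ` K c \<subseteq> {..<card (K c)}" by auto
        show "card (lookup m ` K c) = card {..<card (K c)}" using inj[OF c] by (simp add: card_image)
      qed simp
      moreover have "inj_on (lookup ?M) (K c)"
        using MK finite_K by (intro eq_card_imp_inj_on) simp_all
      ultimately have "sum (lookup m) (K c) = sum (lookup ?M) (K c)"
        using inj[OF c] MK sum.reindex[of "lookup m" "K c" "\<lambda>x. x"]
          sum.reindex[of "lookup ?M" "K c" "\<lambda>x. x"] by simp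
      moreover have "sum (lookup m) (K c) < sum (lookup ?M) (K c)"
        using x by (intro sum_strict_mono_ex1 finite_K) (auto simp: lM)
      ultimately show False by simp
    qed
    then show ?thesis by simp
  qed
  finally show "ncoeff (elem_sym d S \<odot> delta n lam T) m = ncoeff 0 m" by simp
qed

text \<open>Exponents in \<open>\<delta>\<^sub>T\<close> are at most \<open>length lam - 1\<close>;
  for a nonempty list this subtraction is not truncated.\<close>

lemma power_annihilates:
  assumes "0 < length lam"
  shows "(var i ^ length lam) \<odot> delta n lam T = 0"
proof (rule ncoeff_eqI)
  fix m
  have "\<not> lookup (m + single i (length lam)) i \<le> length lam - 1"
    using assms by (simp only: lookup_add lookup_single_eq)
  then have "lookup (delta n lam T) (m + single i (length lam)) = 0"
    using delta_exponent_le by blast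
  then show "ncoeff ((var i ^ length lam) \<odot> delta n lam T) m = ncoeff 0 m"
    by (simp add: ncoeff_odot var_power ncoeff_eq_0_iff)
qed

end

section \<open>The harmonic space\<close>

text \<open>Written over the naturals and with columns from zero, the degree bound matches the
  hypothesis of \<open>monomials_spanned\<close>.\<close>

lemma ideal_gens_iff:
  "f \<in> ideal_gens n lam \<longleftrightarrow> (\<exists>i\<in>{1..n}. f = var i ^ length lam) \<or>
    (\<exists>d S. f = elem_sym d S \<and> S \<subseteq> {1..n} \<and>
      card S < d + (\<Sum>j\<in>{n - card S..<n}. heights lam j))"
proof -
  have "int d > int (card S) - (\<Sum>j\<in>{n - card S + 1..n}. int (conj_part lam j)) \<longleftrightarrow>
      card S < d + (\<Sum>j\<in>{n - card S..<n}. heights lam j)" for d S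
    unfolding sum_conj_part by linarith
  then show ?thesis
    unfolding ideal_gens_def by (simp only: Un_iff mem_Collect_eq) blast
qed

lemma ideal_gens_in_polys: "ideal_gens n lam \<subseteq> polys n"
proof
  fix f assume "f \<in> ideal_gens n lam"
  then consider i where "i \<in> {1..n}" "f = var i ^ length lam"
    | d S where "f = elem_sym d S" "S \<subseteq> {1..n}"
    unfolding ideal_gens_iff by blast
  then show "f \<in> polys n"
  proof cases
    case 1
    then show ?thesis by (auto simp: var_power intro!: single_in_polys split: if_splits)
  next
    case 2
    have "keys (\<Sum>i\<in>A. single i (1::nat)) \<subseteq> {1..n}" if "A \<subseteq> S" for A
    proof -
      have "A \<subseteq> {1..n}" using that 2 by blast
      then show ?thesis using keys_indicator[OF finite_subset[of A "{1..n}"]] by simp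
    qed
    then show ?thesis
      unfolding 2(1) elem_sym_monomials
      by (intro mpoly.subspace_sum[OF subspace_polys] single_in_polys) simp
  qed
qed

lemma mult_in_I_ideal: "f \<in> I_ideal n lam \<Longrightarrow> h \<in> polys n \<Longrightarrow> h * f \<in> I_ideal n lam"
  unfolding I_ideal_def hull_def is_ideal_def by simp

lemma gen_in_I_ideal: "f \<in> ideal_gens n lam \<Longrightarrow> f \<in> I_ideal n lam"
  unfolding I_ideal_def by (rule hull_inc)

lemma pairing_add_right: "pairing f (g + h) = pairing f g + pairing f h"
  and pairing_scale_right: "pairing f (scale c g) = c * pairing f g"
  and pairing_0_right: "pairing f 0 = 0"
  by (simp_all add: pairing_contract contract_def ncoeff_add ncoeff_scale algebra_simps sum.distrib sum_distrib_left)

lemma harmonic_space_closed: "is_pdiff_closed_subspace n (harmonic_space n lam)"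
proof -
  have "pairing f (pdiff i g) = 0"
    if "i \<in> {1..n}" "g \<in> harmonic_space n lam" "f \<in> I_ideal n lam" for i g f
  proof -
    have "var i * f \<in> I_ideal n lam"
      using that unfolding var_def by (intro mult_in_I_ideal single_in_polys) auto
    then show ?thesis using that by (simp add: pairing_pdiff harmonic_space_def)
  qed
  then show ?thesis
    unfolding is_pdiff_closed_subspace_def mpoly.subspace_def
    by (auto simp: harmonic_space_def polys_0 polys_add polys_scale pdiff_in_polys
        pairing_add_right pairing_scale_right pairing_0_right)
qed

text \<open>The annihilator of \<open>\<delta>\<^sub>T\<close> is an ideal, so only generators need
  checking; annihilation is stronger than a vanishing pairing.\<close>

lemma delta_in_harmonic_space:
  assumes T: "T \<in> Inj_fillings lam n" and "0 < length lam"
  shows "delta n lam T \<in> harmonic_space n lam"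
proof -
  interpret filling n lam T by unfold_locales (rule T)
  let ?Ann = "{f \<in> polys n. f \<odot> delta n lam T = 0}"
  have "I_ideal n lam \<subseteq> ?Ann"
    unfolding I_ideal_def
  proof (rule hull_minimal)
    have "f \<odot> delta n lam T = 0" if "f \<in> ideal_gens n lam" for f
      using that power_annihilates[OF assms(2)] elem_sym_annihilates unfolding ideal_gens_iff by blast
    then show "ideal_gens n lam \<subseteq> ?Ann" using ideal_gens_in_polys by blast
    show "is_ideal n ?Ann"
      by (auto simp: is_ideal_def polys_0 polys_add polys_mult odot_0_left odot_0_right
          odot_add_left odot_mult)
  qed
  then show ?thesis
    using delta_in_polys by (auto simp: harmonic_space_def pairing_def)
qed

section \<open>Fillings behind substaircase monomials, and elimination of leading monomials\<close>

lemma substaircase_filling: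
  assumes lam: "sorted_wrt (\<ge>) lam" and a: "substaircase {1..n} (heights lam) (length lam) a"
  obtains T where "T \<in> Inj_fillings lam n" "\<And>i. i \<in> {1..n} \<Longrightarrow> lookup a i \<le> filling_exponent lam T i"
proof -
  from a obtain c where card: "\<And>j. card {i\<in>{1..n}. c i = Some j} = heights lam j"
    and le: "\<And>i. i \<in> {1..n} \<Longrightarrow>
      lookup a i \<le> (if c i = None then length lam - 1 else card {i'\<in>{1..n}. i < i' \<and> c i' = c i})"
    unfolding substaircase_def by blast
  \<comment> \<open>Column \<open>j\<close> is filled with the numbers that \<open>c\<close> assigns
    to it, in increasing order.\<close>
  define C where "C j = {i\<in>{1..n}. c i = Some j}" for j
  define L where "L j = sorted_list_of_set (C j)" for j
  have finC: "finite (C j)" for j by (simp add: C_def)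
  have len: "length (L j) = heights lam j" for j using card[of j] by (simp add: L_def C_def)
  have set: "set (L j) = C j" for j by (simp add: L_def finC)
  have dia: "(r, j) \<in> diagram lam \<longleftrightarrow> r < heights lam j" for r j
  proof -
    have "{r. r < length lam \<and> Suc j \<le> lam ! r} = {..<heights lam j}"
      unfolding heights_def conj_part_def
    proof (rule down_closed_eq_lessThan)
      fix r r' assume "r \<in> {r. r < length lam \<and> Suc j \<le> lam ! r}" "r' < r"
      then show "r' \<in> {r. r < length lam \<and> Suc j \<le> lam ! r}"
        using sorted_wrt_nth_less[OF lam, of r' r] by simp
    qed simp
    then show ?thesis by (auto simp: diagram_def Suc_le_eq)
  qed
  \<comment> \<open>The value \<open>undefined\<close> outside the diagram makes \<open>T\<close>
    extensional, as \<open>Inj_fillings\<close> demands.\<close>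
  define T where "T = (\<lambda>(r, j). if (r, j) \<in> diagram lam then L j ! r else undefined)"
  have T_nth: "T (r, j) = L j ! r" if "r < heights lam j" for r j
    using that by (simp add: T_def dia)
  have TC: "T (r, j) \<in> C j" if "r < heights lam j" for r j
    using that nth_mem[of r "L j"] by (simp add: T_nth len set)
  have inj: "T \<in> Inj_fillings lam n"
    unfolding Inj_fillings_def
  proof (intro CollectI conjI allI impI)
    show "T \<in> diagram lam \<rightarrow>\<^sub>E {1..n}"
    proof
      fix x assume "x \<in> diagram lam"
      then show "T x \<in> {1..n}" using TC by (cases x) (auto simp: dia C_def)
    qed (auto simp: T_def)
    show "inj_on T (diagram lam)"
    proof (rule inj_onI, clarify)
      fix r j r' j' assume *: "(r, j) \<in> diagram lam" "(r', j') \<in> diagram lam" "T (r, j) = T (r', j')"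
      then have j: "j = j'" using TC[of r j] TC[of r' j'] by (simp add: dia C_def)
      then have "L j ! r = L j ! r'" using * by (simp add: dia T_nth)
      then have "r = r'" using * j by (subst (asm) nth_eq_iff_index_eq) (simp_all add: len dia, simp add: L_def)
      then show "r = r' \<and> j = j'" using j by simp
    qed
    fix r r' j assume "(r, j) \<in> diagram lam" "(r', j) \<in> diagram lam" "r < r'"
    then show "T (r, j) < T (r', j)"
      using sorted_wrt_nth_less[OF strict_sorted_list_of_set, of r r' "C j"]
      by (simp add: dia T_nth flip: L_def) (simp add: len)
  qed
  then interpret filling n lam T by unfold_locales
  have K: "K j = C j" for j
  proof -
    have "K j = {L j ! r | r. r < length (L j)}"
      unfolding column_entries_def dia len
      by (rule Collect_cong, rule iff_exI) (auto simp: T_nth)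
    then show ?thesis by (simp add: set flip: set_conv_nth)
  qed
  have "lookup a i \<le> filling_exponent lam T i" if i: "i \<in> {1..n}" for i
  proof (cases "c i")
    case None
    then have "i \<notin> T ` diagram lam" by (simp add: in_image_iff K C_def)
    then show ?thesis using le[OF i] None by (simp add: filling_exponent_def)
  next
    case (Some j)
    then have "i \<in> K j" using i by (simp add: K C_def)
    then have "filling_exponent lam T i = card {i'\<in>{1..n}. i < i' \<and> c i' = c i}"
      by (subst E_column) (auto simp: K C_def Some intro!: arg_cong[where f = card])
    then show ?thesis using le[OF i] Some by simp
  qed
  with inj show ?thesis by (rule that)
qed

text \<open>Exponents are bounded by those of some filling, hence uniformly by
  \<open>length lam - 1\<close>. Finiteness lets the elimination proceed by induction.\<close>

lemma finite_substaircase: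
  assumes lam: "sorted_wrt (\<ge>) lam"
  shows "finite {a. substaircase {1..n} (heights lam) (length lam) a}" (is "finite ?A")
proof (rule finite_subset)
  let ?F = "\<lambda>f. \<Sum>i\<in>{1..n}. single i (f i)"
  show "?A \<subseteq> ?F ` ({1..n} \<rightarrow>\<^sub>E {..length lam - 1})"
  proof
    fix a assume "a \<in> ?A"
    then have a: "substaircase {1..n} (heights lam) (length lam) a" by simp
    then have ka: "keys a \<subseteq> {1..n}" by (simp add: substaircase_def)
    obtain T where T: "T \<in> Inj_fillings lam n" and
      le: "\<And>i. i \<in> {1..n} \<Longrightarrow> lookup a i \<le> filling_exponent lam T i"
      using substaircase_filling[OF lam a] by blast
    interpret filling n lam T by unfold_locales (rule T)
    have "a = ?F (restrict (lookup a) {1..n})"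
      using sum_single_lookup[OF _ ka] by simp
    moreover have "restrict (lookup a) {1..n} \<in> {1..n} \<rightarrow>\<^sub>E {..length lam - 1}"
      using order_trans[OF le E_le] by auto
    ultimately show "a \<in> ?F ` ({1..n} \<rightarrow>\<^sub>E {..length lam - 1})" by blast
  qed
qed (intro finite_imageI finite_PiE; simp)

text \<open>Coefficients are cleared from the largest index downwards: subtracting a multiple of an
  element with leading monomial \<open>b\<close> leaves all larger coefficients untouched.\<close>

lemma triangular_elimination:
  assumes W: "mpoly.subspace W" and "finite A"
    and "\<And>a. a \<in> A \<Longrightarrow> \<exists>w\<in>W. lookup w a \<noteq> 0 \<and> (\<forall>m. a < m \<longrightarrow> lookup w m = 0)"
  shows "\<exists>w\<in>W. \<forall>a\<in>A. lookup (g - w) a = 0"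
  using assms(2,3)
proof (induction A rule: finite_linorder_min_induct)
  case empty
  then show ?case using mpoly.subspace_0[OF W] by auto
next
  case (insert b A)
  then obtain w where w: "w \<in> W" "\<forall>a\<in>A. lookup (g - w) a = 0" by (metis insertCI)
  obtain u where u: "u \<in> W" "lookup u b \<noteq> 0" "\<forall>m. b < m \<longrightarrow> lookup u m = 0"
    using insert.prems by blast
  define c where "c = lookup (g - w) b / lookup u b"
  have "w + scale c u \<in> W" by (intro mpoly.subspace_add mpoly.subspace_scale W w u)
  moreover have "lookup (g - (w + scale c u)) a = 0" if "a \<in> insert b A" for a
    using that w(2) u insert.hyps by (auto simp: lookup_minus lookup_add c_def)
  ultimately show ?case by blast
qed

text \<open>Differentiating by the quotient of x(T) and the monomial \<open>a\<close> shifts the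
  leading exponent \<open>top_exp\<close> to \<open>a\<close>; larger exponents stay absent since
  the order is compatible with addition.\<close>

lemma leading_derivative:
  assumes lam: "sorted_wrt (\<ge>) lam" and a: "substaircase {1..n} (heights lam) (length lam) a"
    and W: "is_pdiff_closed_subspace n W" "delta n lam ` Inj_fillings lam n \<subseteq> W"
  shows "\<exists>w\<in>W. lookup w a \<noteq> 0 \<and> (\<forall>m. a < m \<longrightarrow> lookup w m = 0)"
proof -
  obtain T where T: "T \<in> Inj_fillings lam n" and
    le: "\<And>i. i \<in> {1..n} \<Longrightarrow> lookup a i \<le> filling_exponent lam T i"
    using substaircase_filling[OF lam a] by blast
  interpret filling n lam T by unfold_locales (rule T)
  have ka: "keys a \<subseteq> {1..n}" using a by (simp add: substaircase_def)
  let ?b = "top_exp - a"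
  have split: "a + ?b = top_exp"
  proof (rule poly_mapping_eqI)
    fix i
    have "lookup a i = 0" if "i \<notin> {1..n}" using ka that by (auto simp: in_keys_iff)
    then show "lookup (a + ?b) i = lookup top_exp i"
      using le[of i] by (auto simp: lookup_add lookup_minus lookup_top)
  qed
  have "keys ?b \<subseteq> {1..n}"
    by (auto simp: in_keys_iff lookup_minus lookup_top split: if_splits)
  then have "pdiff_monom ?b (delta n lam T) \<in> W"
    using W T by (intro pdiff_monom_closed) auto
  moreover have "lookup (pdiff_monom ?b (delta n lam T)) a \<noteq> 0"
    using delta_top by (simp add: ncoeff_eq_0_iff[symmetric] ncoeff_pdiff_monom split)
      (simp add: ncoeff_eq_0_iff)
  moreover have "lookup (pdiff_monom ?b (delta n lam T)) m = 0" if "a < m" for m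
  proof -
    have "top_exp < m + ?b" using add_strict_right_mono[OF that, of ?b] by (simp add: split)
    then have "lookup (delta n lam T) (m + ?b) = 0" using delta_leading[of "m + ?b"] by force
    then show ?thesis by (simp add: ncoeff_eq_0_iff[symmetric] ncoeff_pdiff_monom)
  qed
  ultimately show ?thesis by blast
qed

text \<open>The kernel of the pairing with \<open>g\<close> contains the monomial multiples of the
  generators and, by assumption, the substaircase monomials, hence every monomial; and a monomial
  pairs with \<open>g\<close> to a nonzero multiple of its coefficient in \<open>g\<close>.\<close>

lemma harmonic_eq_0I:
  assumes g: "g \<in> harmonic_space n lam" and bound: "\<And>j. n \<le> j \<Longrightarrow> heights lam j = 0"
    and zero: "\<And>a. substaircase {1..n} (heights lam) (length lam) a \<Longrightarrow> lookup g a = 0"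
  shows "g = 0"
proof (rule poly_mapping_eqI)
  fix m
  show "lookup g m = lookup 0 m"
  proof (cases "keys m \<subseteq> {1..n}")
    case False
    then show ?thesis using g by (auto simp: harmonic_space_def polys_iff)
  next
    case True
    define U where "U = {f. pairing f g = 0}"
    have I: "single q 1 * f \<in> U" if "f \<in> ideal_gens n lam" "keys q \<subseteq> {1..n}" for q f
      using g mult_in_I_ideal[OF gen_in_I_ideal[OF that(1)] single_in_polys[OF that(2)]]
      by (simp add: U_def harmonic_space_def)
    have "single m 1 \<in> U"
    proof (rule monomials_spanned[OF _ antimono_heights bound])
      show "mpoly.subspace U"
        by (simp add: U_def mpoly.subspace_def pairing_contract contract_add contract_scale)
      show "single q 1 * var i ^ length lam \<in> U" if "i \<in> {1..n}" "keys q \<subseteq> {1..n}" for i q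
        using that by (intro I) (auto simp: ideal_gens_iff)
      show "single q 1 * elem_sym d S \<in> U"
        if "S \<subseteq> {1..n}" "card S < d + (\<Sum>j\<in>{card {1..n} - card S..<n}. heights lam j)"
          "keys q \<subseteq> {1..n}" for S d q
        using that by (intro I) (auto simp: ideal_gens_iff)
      show "single a 1 \<in> U" if "substaircase {1..n} (heights lam) (length lam) a" for a
        using zero[OF that] by (simp add: U_def pairing_contract ncoeff_eq_0_iff)
    qed (use True in auto)
    then show ?thesis by (simp add: U_def pairing_contract ncoeff_eq_0_iff)
  qed
qed

lemma harmonic_space_minimal:
  assumes lam: "is_partition k s lam" and "k \<le> n" "0 < k"
    and W: "is_pdiff_closed_subspace n W" "delta n lam ` Inj_fillings lam n \<subseteq> W"
  shows "harmonic_space n lam \<subseteq> W"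
proof
  fix g assume g: "g \<in> harmonic_space n lam"
  let ?V = "harmonic_space n lam"
  have sorted: "sorted_wrt (\<ge>) lam" and k: "sum_list lam = k"
    using lam by (auto simp: is_partition_def)
  then have len: "0 < length lam" using \<open>0 < k\<close> by (cases lam) auto
  have V: "mpoly.subspace ?V"
    using harmonic_space_closed by (simp add: is_pdiff_closed_subspace_def)
  \<comment> \<open>Elimination takes place within the intersection so that the remainder
    \<open>g - w\<close> is still harmonic.\<close>
  have WV: "is_pdiff_closed_subspace n (W \<inter> ?V)"
    using W(1) harmonic_space_closed[of n lam]
    by (auto simp: is_pdiff_closed_subspace_def intro: mpoly.subspace_inter)
  have dWV: "delta n lam ` Inj_fillings lam n \<subseteq> W \<inter> ?V"
    using W(2) delta_in_harmonic_space len by blast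
  obtain w where w: "w \<in> W \<inter> ?V"
    and zero: "\<And>a. substaircase {1..n} (heights lam) (length lam) a \<Longrightarrow> lookup (g - w) a = 0"
    using triangular_elimination[OF _ finite_substaircase[OF sorted, of n], of "W \<inter> ?V" g]
      leading_derivative[OF sorted _ WV dWV] WV
    by (auto simp: is_pdiff_closed_subspace_def)
  have "g - w = 0"
  proof (rule harmonic_eq_0I)
    show "g - w \<in> ?V" using g w by (intro mpoly.subspace_diff[OF V]) auto
    \<comment> \<open>No part exceeds \<open>k\<close>, hence none exceeds \<open>n\<close>, so the
      columns from \<open>n\<close> on are empty.\<close>
    show "heights lam j = 0" if "n \<le> j" for j
    proof -
      have "lam ! r \<le> j" if "r < length lam" for r
        using member_le_sum_list[OF nth_mem[OF that]] k \<open>k \<le> n\<close> \<open>n \<le> j\<close> by simp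
      then show ?thesis by (auto simp: heights_def conj_part_def Suc_le_eq dest: leD)
    qed
  qed (rule zero)
  then show "g \<in> W" using w by simp
qed

theorem theorem4p7:
  fixes k n s :: nat and lam :: "nat list"
  assumes "0 < k" and "k \<le> n" and "is_partition k s lam"
  shows "is_pdiff_closed_subspace n (harmonic_space n lam)
       \<and> delta n lam ` Inj_fillings lam n \<subseteq> harmonic_space n lam
       \<and> (\<forall>W. is_pdiff_closed_subspace n W \<longrightarrow> delta n lam ` Inj_fillings lam n \<subseteq> W
              \<longrightarrow> harmonic_space n lam \<subseteq> W)
       \<and> harmonic_space n lam = is_odot_submodule n hull (delta n lam ` Inj_fillings lam n)"
proof -
  let ?V = "harmonic_space n lam" and ?X = "delta n lam ` Inj_fillings lam n"
  have "0 < length lam" using assms by (cases lam) (auto simp: is_partition_def)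
  then have delta: "?X \<subseteq> ?V" using delta_in_harmonic_space by blast
  have minimal: "?V \<subseteq> W" if "is_pdiff_closed_subspace n W" "?X \<subseteq> W" for W
    using harmonic_space_minimal[OF assms(3,2,1) that] .
  \<comment> \<open>Submodules are the closed subspaces, so the hull lies in \<open>?V\<close>
    because \<open>?V\<close> is one of those containing \<open>?X\<close>, and it contains
    \<open>?V\<close> because each of those does.\<close>
  have "is_odot_submodule n hull ?X \<subseteq> ?V"
    using delta harmonic_space_closed by (intro hull_minimal) (simp_all add: odot_submodule_iff)
  moreover have "?V \<subseteq> is_odot_submodule n hull ?X"
    using minimal unfolding hull_def odot_submodule_iff by blast
  ultimately show ?thesis
    using harmonic_space_closed delta minimal by blast
qed

end
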